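(* Let $n\ge 3$ and let $C_s>0$ be a constant depending only on $n$ such that the Sobolev inequality $$\Big(\int_M|f|^{\frac{2n}{n-2}}\,dv\Big)^{\frac{n-2}{n}}\le C_s\int_M|\nabla f|^2\,dv$$ holds for every complete minimal hypersurface $M$ in $\mathbb{H}^{n+1}$ and every compactly supported Lipschitz function $f$ on $M$. Let $M$ be a complete minimal hypersurface in $\mathbb{H}^{n+1}$ with second fundamental form $A$. If $$\int_M|A|^n\,dv\le\Big(\frac1{C_s}\Big)^{\frac n2},$$ then $M$ is stable.
   Context: $\mathbb{H}^{n+1}$ is the $(n+1)$-dimensional hyperbolic space of constant sectional curvature $-1$. Hypersurfaces of $\mathbb{H}^{n+1}$ have dimension $n$, and $dv$ is the volume form of the induced metric. The existence of a constant $C_s$ as in the claim is a known result (Hoffman–Spruck). A minimal hypersurface $M$ in $\mathbb{H}^{n+1}$ with second fundamental form $A$ is called stable if for every compactly supported Lipschitz function $f$ on $M$ $$\int_M |\nabla f|^2-(|A|^2-n)f^2\,dv\ge 0.$$ *)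

theory Defs
  imports "HOL-Analysis.Analysis"
begin

section \<open>Smooth maps between Euclidean spaces\<close>

definition partial_deriv ::
    "(real^'n::finite \<Rightarrow> 'b::real_normed_vector) \<Rightarrow> 'n \<Rightarrow> real^'n \<Rightarrow> 'b" where
  "partial_deriv f i x = frechet_derivative f (at x) (axis i 1)"

primrec Ck_on ::
    "nat \<Rightarrow> (real^'n::finite) set \<Rightarrow> (real^'n \<Rightarrow> 'b::real_normed_vector) \<Rightarrow> bool" where
  "Ck_on 0 U f \<longleftrightarrow> continuous_on U f"
| "Ck_on (Suc k) U f \<longleftrightarrow> (\<forall>x\<in>U. f differentiable (at x)) \<and> (\<forall>i. Ck_on k U (partial_deriv f i))"

text \<open>Meaningful for open \<open>U\<close> only.\<close>

definition smooth_on ::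
    "(real^'n::finite) set \<Rightarrow> (real^'n \<Rightarrow> 'b::real_normed_vector) \<Rightarrow> bool" where
  "smooth_on U f \<longleftrightarrow> (\<forall>k. Ck_on k U f)"


section \<open>Hyperbolic space\<close>

text \<open>
  Hyperbolic space of dimension \<open>CARD('n) + 1\<close> and curvature \<open>-1\<close> is the upper sheet of the
  hyperboloid in Minkowski space \<open>\<real>\<^sup>n \<times> \<real> \<times> \<real>\<close>, whose last coordinate is timelike. Its Riemannian
  metric is the restriction of the Lorentz form to the tangent spaces.
\<close>

type_synonym 'n minkowski = "((real^'n) \<times> real) \<times> real"

definition lorentz :: "'n::finite minkowski \<Rightarrow> 'n minkowski \<Rightarrow> real" where
  "lorentz v w = fst v \<bullet> fst w - snd v * snd w"

definition hyperbolic_space :: "'n::finite minkowski set" where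
  "hyperbolic_space = {z. lorentz z z = -1 \<and> snd z > 0}"

text \<open>
  Lorentz-orthogonal projection of Minkowski space onto the tangent space of hyperbolic space at
  \<open>z\<close>, which is the Lorentz-orthogonal complement of \<open>z\<close>; the sign is due to \<open>lorentz z z = -1\<close>.
\<close>

definition hyp_proj :: "'n::finite minkowski \<Rightarrow> 'n minkowski \<Rightarrow> 'n minkowski" where
  "hyp_proj z w = w + lorentz w z *\<^sub>R z"


section \<open>Immersed hypersurfaces\<close>

text \<open>
  A chart \<open>(U, \<phi>)\<close> is a local parametrization \<open>\<phi>\<close> of the manifold, defined on \<open>U \<subseteq> \<real>\<^sup>n\<close>. The field
  \<open>pos\<close> is the immersion into hyperbolic space. Self-intersections are allowed, and connectedness is
  not required. The points are taken from a type \<open>'a\<close>; second countable manifolds have at most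
  continuum many points, so that \<open>'a = real\<close> already covers all of them up to isometry.
\<close>

type_synonym ('a, 'n) chart = "(real^'n) set \<times> (real^'n \<Rightarrow> 'a)"

record ('a, 'n) hypersurface =
  topo :: "'a topology"
  charts :: "('a, 'n) chart set"
  pos :: "'a \<Rightarrow> 'n minkowski"

definition smooth_manifold :: "('a, 'n::finite, 'z) hypersurface_scheme \<Rightarrow> bool" where
  "smooth_manifold M \<longleftrightarrow>
     Hausdorff_space (topo M) \<and> second_countable (topo M) \<and>
     (\<forall>(U, \<phi>) \<in> charts M.
        open U \<and> openin (topo M) (\<phi> ` U) \<and>
        homeomorphic_map (top_of_set U) (subtopology (topo M) (\<phi> ` U)) \<phi>) \<and>
     topspace (topo M) = (\<Union>(U, \<phi>) \<in> charts M. \<phi> ` U) \<and>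
     (\<forall>(U, \<phi>) \<in> charts M. \<forall>(V, \<psi>) \<in> charts M.
        smooth_on {x \<in> U. \<phi> x \<in> \<psi> ` V} (inv_into V \<psi> \<circ> \<phi>))"

definition immersed_hypersurface :: "('a, 'n::finite, 'z) hypersurface_scheme \<Rightarrow> bool" where
  "immersed_hypersurface M \<longleftrightarrow>
     smooth_manifold M \<and>
     pos M ` topspace (topo M) \<subseteq> hyperbolic_space \<and>
     (\<forall>(U, \<phi>) \<in> charts M.
        smooth_on U (pos M \<circ> \<phi>) \<and>
        (\<forall>x\<in>U. inj (frechet_derivative (pos M \<circ> \<phi>) (at x))))"


section \<open>Local geometry\<close>

text \<open>
  In this section \<open>X = pos M \<circ> \<phi>\<close> is the immersion in a chart \<open>(U, \<phi>)\<close>, and \<open>x \<in> U\<close>.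
\<close>

definition induced_metric :: "(real^'n::finite \<Rightarrow> 'n minkowski) \<Rightarrow> real^'n \<Rightarrow> real^'n^'n" where
  "induced_metric X x = (\<chi> i j. lorentz (partial_deriv X i x) (partial_deriv X j x))"

abbreviation inv_metric :: "(real^'n::finite \<Rightarrow> 'n minkowski) \<Rightarrow> real^'n \<Rightarrow> real^'n^'n" where
  "inv_metric X x \<equiv> matrix_inv (induced_metric X x)"

text \<open>
  Orthogonal projection onto the tangent space of the hypersurface, for \<open>w\<close> tangent to hyperbolic
  space at \<open>X x\<close>.
\<close>

definition tangent_proj ::
    "(real^'n::finite \<Rightarrow> 'n minkowski) \<Rightarrow> real^'n \<Rightarrow> 'n minkowski \<Rightarrow> 'n minkowski" where
  "tangent_proj X x w =
     (\<Sum>k\<in>UNIV. \<Sum>l\<in>UNIV.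
        (inv_metric X x $ k $ l * lorentz w (partial_deriv X k x)) *\<^sub>R partial_deriv X l x)"

text \<open>
  The Levi-Civita derivative in hyperbolic space of the coordinate field \<open>\<partial>\<^sub>j X\<close> in direction \<open>\<partial>\<^sub>i X\<close>:
  the tangential part of the flat derivative of Minkowski space.
\<close>

definition hyp_connection ::
    "(real^'n::finite \<Rightarrow> 'n minkowski) \<Rightarrow> 'n \<Rightarrow> 'n \<Rightarrow> real^'n \<Rightarrow> 'n minkowski" where
  "hyp_connection X i j x = hyp_proj (X x) (partial_deriv (partial_deriv X j) i x)"

text \<open>
  The second fundamental form is taken with values in the normal bundle, so that no unit normal
  (hence no orientation) has to be chosen.
\<close>

definition second_ff ::
    "(real^'n::finite \<Rightarrow> 'n minkowski) \<Rightarrow> 'n \<Rightarrow> 'n \<Rightarrow> real^'n \<Rightarrow> 'n minkowski" where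
  "second_ff X i j x = hyp_connection X i j x - tangent_proj X x (hyp_connection X i j x)"

definition mean_curvature :: "(real^'n::finite \<Rightarrow> 'n minkowski) \<Rightarrow> real^'n \<Rightarrow> 'n minkowski" where
  "mean_curvature X x = (\<Sum>i\<in>UNIV. \<Sum>j\<in>UNIV. (inv_metric X x $ i $ j) *\<^sub>R second_ff X i j x)"

definition second_ff_sq :: "(real^'n::finite \<Rightarrow> 'n minkowski) \<Rightarrow> real^'n \<Rightarrow> real" where
  "second_ff_sq X x =
     (\<Sum>i\<in>UNIV. \<Sum>j\<in>UNIV. \<Sum>k\<in>UNIV. \<Sum>l\<in>UNIV.
        inv_metric X x $ i $ k * inv_metric X x $ j $ l *
        lorentz (second_ff X i j x) (second_ff X k l x))"

text \<open>
  Lipschitz functions are differentiable almost everywhere only; at the remaining points the value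
  is \<open>0\<close> by convention.
\<close>

definition local_grad_sq ::
    "(real^'n::finite \<Rightarrow> 'n minkowski) \<Rightarrow> (real^'n \<Rightarrow> real) \<Rightarrow> real^'n \<Rightarrow> real" where
  "local_grad_sq X h x =
     (if h differentiable (at x)
      then \<Sum>i\<in>UNIV. \<Sum>j\<in>UNIV. inv_metric X x $ i $ j * partial_deriv h i x * partial_deriv h j x
      else 0)"


section \<open>Global geometry\<close>

definition minimal :: "('a, 'n::finite, 'z) hypersurface_scheme \<Rightarrow> bool" where
  "minimal M \<longleftrightarrow> (\<forall>(U, \<phi>) \<in> charts M. \<forall>x\<in>U. mean_curvature (pos M \<circ> \<phi>) x = 0)"

text \<open>
  The following two quantities do not depend on the chart around \<open>p\<close>, so an arbitrary one is used.
\<close>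

definition chart_at ::
    "('a, 'n::finite, 'z) hypersurface_scheme \<Rightarrow> 'a \<Rightarrow> (real^'n \<Rightarrow> 'a) \<times> (real^'n)" where
  "chart_at M p = (SOME (\<phi>, x). \<exists>U. (U, \<phi>) \<in> charts M \<and> x \<in> U \<and> \<phi> x = p)"

definition normA :: "('a, 'n::finite, 'z) hypersurface_scheme \<Rightarrow> 'a \<Rightarrow> real" where
  "normA M p = (case chart_at M p of (\<phi>, x) \<Rightarrow> sqrt (second_ff_sq (pos M \<circ> \<phi>) x))"

definition grad_sq ::
    "('a, 'n::finite, 'z) hypersurface_scheme \<Rightarrow> ('a \<Rightarrow> real) \<Rightarrow> 'a \<Rightarrow> real" where
  "grad_sq M f p = (case chart_at M p of (\<phi>, x) \<Rightarrow> local_grad_sq (pos M \<circ> \<phi>) (f \<circ> \<phi>) x)"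

definition borel_on :: "'a topology \<Rightarrow> 'a measure" where
  "borel_on T = sigma (topspace T) {S. openin T S}"

text \<open>
  The Riemannian volume of the image of one chart, as a measure on the whole of \<open>M\<close>.
\<close>

definition chart_volume ::
    "('a, 'n::finite, 'z) hypersurface_scheme \<Rightarrow> ('a, 'n) chart \<Rightarrow> 'a measure" where
  "chart_volume M = (\<lambda>(U, \<phi>).
     distr
       (density (restrict_space lborel U) (\<lambda>x. ennreal (sqrt (det (induced_metric (pos M \<circ> \<phi>) x)))))
       (borel_on (topo M)) \<phi>)"

text \<open>
  The measures \<open>chart_volume M c\<close> agree on overlaps of charts by the transformation formula, and the
  Riemannian measure \<open>dv\<close> is their common extension. As \<open>M\<close> is second countable, it is also their
  least upper bound, which is how it is defined here; see \<open>riem_volume_eqI\<close> below.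
\<close>

definition riem_volume :: "('a, 'n::finite, 'z) hypersurface_scheme \<Rightarrow> 'a measure" where
  "riem_volume M = (SUP c \<in> charts M. chart_volume M c)"

lemma space_borel_on [simp]: "space (borel_on T) = topspace T"
  unfolding borel_on_def by (rule space_measure_of) (auto dest: openin_subset)

lemma sets_borel_on: "sets (borel_on T) = sigma_sets (topspace T) {S. openin T S}"
  unfolding borel_on_def by (rule sets_measure_of) (auto dest: openin_subset)

lemma borel_on_open: "openin T S \<Longrightarrow> S \<in> sets (borel_on T)"
  by (simp add: sets_borel_on)

lemma sets_chart_volume [simp]: "sets (chart_volume M c) = sets (borel_on (topo M))"
  by (simp add: chart_volume_def split: prod.split)

lemma continuous_on_metric_det:
  assumes "smooth_on U X"
  shows "continuous_on U (\<lambda>x. det (induced_metric X x))"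
proof -
  have c: "continuous_on U (partial_deriv X i)" for i
    using assms[unfolded smooth_on_def, rule_format, of "Suc 0"] by simp
  show ?thesis
    unfolding det_def induced_metric_def lorentz_def
    by (auto intro!: continuous_intros c)
qed

lemma emeasure_chart_volume:
  assumes "immersed_hypersurface M" "(U, \<phi>) \<in> charts M" "B \<in> sets (borel_on (topo M))"
  shows "emeasure (chart_volume M (U, \<phi>)) B =
           (\<integral>\<^sup>+x\<in>{x\<in>U. \<phi> x \<in> B}. ennreal (sqrt (det (induced_metric (pos M \<circ> \<phi>) x))) \<partial>lborel)"
proof -
  let ?X = "pos M \<circ> \<phi>" and ?h = "\<lambda>x. ennreal (sqrt (det (induced_metric (pos M \<circ> \<phi>) x)))"
  let ?R = "restrict_space lborel U"
  have o: "open U" and hom: "homeomorphic_map (top_of_set U) (subtopology (topo M) (\<phi> ` U)) \<phi>"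
    and sm: "smooth_on U ?X" and im: "openin (topo M) (\<phi> ` U)"
    using assms unfolding immersed_hypersurface_def smooth_manifold_def by auto
  have U: "U \<in> sets lborel" using o by simp
  have h: "?h \<in> borel_measurable ?R"
  proof -
    have "continuous_on U (\<lambda>x. sqrt (det (induced_metric ?X x)))"
      by (intro continuous_intros continuous_on_metric_det sm)
    from borel_measurable_continuous_on_restrict[OF this]
    have "(\<lambda>x. sqrt (det (induced_metric ?X x))) \<in> borel_measurable ?R"
      by (simp add: measurable_cong_sets[OF sets_restrict_space_cong[OF sets_lborel] refl])
    then show ?thesis by measurable
  qed
  have cm: "continuous_map (top_of_set U) (topo M) \<phi>"
    using homeomorphic_imp_continuous_map[OF hom] continuous_map_in_subtopology by blast
  have "\<phi> \<in> measurable ?R (borel_on (topo M))"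
    unfolding borel_on_def
  proof (rule measurable_measure_of)
    show "{S. openin (topo M) S} \<subseteq> Pow (topspace (topo M))" by (auto dest: openin_subset)
    show "\<phi> \<in> space ?R \<rightarrow> topspace (topo M)"
      using openin_subset[OF im] by (auto simp: space_restrict_space)
    fix S assume "S \<in> {S. openin (topo M) S}"
    then have "openin (top_of_set U) {x \<in> topspace (top_of_set U). \<phi> x \<in> S}"
      using openin_continuous_map_preimage[OF cm] by blast
    then have "open {x\<in>U. \<phi> x \<in> S}" using o openin_open_eq by auto
    then show "\<phi> -` S \<inter> space ?R \<in> sets ?R"
      using U by (auto simp: space_restrict_space sets_restrict_space_iff vimage_def Int_def conj_commute)
  qed
  then have m: "\<phi> \<in> measurable (density ?R ?h) (borel_on (topo M))" by simp
  have P: "\<phi> -` B \<inter> space ?R \<in> sets ?R"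
    using measurable_sets[OF m assms(3)] by simp
  have "emeasure (chart_volume M (U, \<phi>)) B = (\<integral>\<^sup>+x. ?h x * indicator (\<phi> -` B \<inter> space ?R) x \<partial>?R)"
    unfolding chart_volume_def prod.case
    by (simp add: emeasure_distr[OF m assms(3)] emeasure_density[OF h P])
  also have "\<dots> = (\<integral>\<^sup>+x. ?h x * indicator (\<phi> -` B \<inter> space ?R) x * indicator U x \<partial>lborel)"
    using U by (subst nn_integral_restrict_space) auto
  also have "\<dots> = (\<integral>\<^sup>+x\<in>{x\<in>U. \<phi> x \<in> B}. ?h x \<partial>lborel)"
    by (intro nn_integral_cong) (auto simp: indicator_def space_restrict_space)
  finally show ?thesis .
qed

lemma riem_volume_eqI:
  assumes M: "smooth_manifold M" and sN: "sets N = sets (borel_on (topo M))"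
    and N: "\<And>U \<phi> B. (U, \<phi>) \<in> charts M \<Longrightarrow> B \<in> sets N \<Longrightarrow>
              emeasure (chart_volume M (U, \<phi>)) B = emeasure N (B \<inter> \<phi> ` U)"
  shows "riem_volume M = N"
proof (cases "charts M = {}")
  case True
  then have e: "topspace (topo M) = {}" using M by (auto simp: smooth_manifold_def)
  then have s: "space N = {}" using sets_eq_imp_space_eq[OF sN] by simp
  show ?thesis
    using True space_empty[OF s] space_empty[of "bot :: 'a measure"] by (simp add: riem_volume_def)
next
  case False
  have sets: "sets (riem_volume M) = sets N"
    unfolding riem_volume_def by (rule sets_SUP) (use False sN in auto)
  have op: "openin (topo M) (snd c ` fst c)" if "c \<in> charts M" for c
    using M that unfolding smooth_manifold_def by auto
  have cov: "topspace (topo M) = (\<Union>c\<in>charts M. snd c ` fst c)"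
    using M by (auto simp: smooth_manifold_def case_prod_beta)
  have opN: "snd c ` fst c \<in> sets N" if "c \<in> charts M" for c
    using op[OF that] sN by (simp add: borel_on_open)
  have up: "emeasure (riem_volume M) B \<le> emeasure N B" if "B \<in> sets N" for B
  proof -
    have "riem_volume M \<le> N" unfolding riem_volume_def
    proof (rule SUP_least)
      fix c assume c: "c \<in> charts M"
      have "emeasure (chart_volume M c) B \<le> emeasure N B" for B
      proof (cases "B \<in> sets N")
        case True
        then have "emeasure (chart_volume M c) B = emeasure N (B \<inter> snd c ` fst c)"
          using N[of "fst c" "snd c" B] c by simp
        also have "\<dots> \<le> emeasure N B" by (rule emeasure_mono) (use True in auto)
        finally show ?thesis .
      qed (simp add: emeasure_notin_sets sN)
      then show "chart_volume M c \<le> N"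
        by (subst le_measure) (auto simp: sN le_fun_def)
    qed
    then show ?thesis using le_measure[of "riem_volume M" N] sets that by (auto simp: le_fun_def)
  qed
  have "Lindelof_space (topo M)"
    using M second_countable_imp_Lindelof_space by (auto simp: smooth_manifold_def)
  then have "\<exists>W. countable W \<and> W \<subseteq> (\<lambda>c. snd c ` fst c) ` charts M \<and> topspace (topo M) \<subseteq> \<Union>W"
    unfolding Lindelof_space_alt by (elim allE[where x = "(\<lambda>c. snd c ` fst c) ` charts M"]) (use op cov in auto)
  then obtain W where W: "countable W" "W \<subseteq> (\<lambda>c. snd c ` fst c) ` charts M"
      "topspace (topo M) \<subseteq> \<Union>W"
    by blast
  from W(1,2) obtain C where C': "countable C" "C \<subseteq> charts M" "W = (\<lambda>c. snd c ` fst c) ` C"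
    using countable_subset_image[of W "\<lambda>c. snd c ` fst c" "charts M"] by blast
  with W(3) have C: "countable C" "C \<subseteq> charts M" "topspace (topo M) \<subseteq> (\<Union>c\<in>C. snd c ` fst c)"
    by auto
  show ?thesis
  proof (cases "C = {}")
    case True
    then have "topspace (topo M) = {}" using C by auto
    then have "space N = {}" "space (riem_volume M) = {}"
      using sets_eq_imp_space_eq[OF sN] sets_eq_imp_space_eq[OF sets] by auto
    then show ?thesis using space_empty by metis
  next
    case Cn: False
    define c where "c = from_nat_into C"
    have c: "c i \<in> charts M" for i
      using C Cn from_nat_into[of C i] unfolding c_def by blast
    define P where "P i = snd (c i) ` fst (c i)" for i
    have PN: "range P \<subseteq> sets N" using opN c unfolding P_def by auto
    have cP: "topspace (topo M) \<subseteq> (\<Union>i. P i)"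
    proof
      fix x assume "x \<in> topspace (topo M)"
      then obtain d where "d \<in> C" "x \<in> snd d ` fst d" using C by auto
      moreover from \<open>d \<in> C\<close> C obtain i where "c i = d"
        unfolding c_def using from_nat_into_surj by metis
      ultimately show "x \<in> (\<Union>i. P i)" unfolding P_def by auto
    qed
    have low: "emeasure N B \<le> emeasure (riem_volume M) B" if B: "B \<in> sets N" for B
    proof -
      let ?D = "\<lambda>i. B \<inter> disjointed P i"
      have D: "range ?D \<subseteq> sets N"
        using sets.range_disjointed_sets[OF PN] B by blast
      have dis: "disjoint_family ?D"
        using disjoint_family_disjointed[of P] by (auto simp: disjoint_family_on_def)
      have "B \<subseteq> topspace (topo M)" using sets.sets_into_space[OF B] sets_eq_imp_space_eq[OF sN] by simp
      then have U: "(\<Union>i. ?D i) = B" using cP UN_disjointed_eq[of P] by auto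
      have "emeasure N (?D i) \<le> emeasure (riem_volume M) (?D i)" for i
      proof -
        have "?D i = ?D i \<inter> snd (c i) ` fst (c i)"
          using disjointed_subset[of P i] by (auto simp: P_def)
        then have "emeasure N (?D i) = emeasure (chart_volume M (c i)) (?D i)"
          using N[of "fst (c i)" "snd (c i)" "?D i"] c D by auto
        also have "\<dots> \<le> emeasure (riem_volume M) (?D i)"
          using SUP_upper[OF c[of i], of "chart_volume M"] sets sN D
            le_measure[of "chart_volume M (c i)" "riem_volume M"]
          by (auto simp: riem_volume_def le_fun_def image_subset_iff)
        finally show ?thesis .
      qed
      then have "(\<Sum>i. emeasure N (?D i)) \<le> (\<Sum>i. emeasure (riem_volume M) (?D i))"
        by (intro suminf_le) auto
      then show ?thesis
        using suminf_emeasure[OF D dis] suminf_emeasure[of ?D "riem_volume M"] D dis sets U by simp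
    qed
    show ?thesis
      by (rule measure_eqI[OF sets]) (use up low sets in \<open>auto intro: antisym\<close>)
  qed
qed

text \<open>
  Since \<open>pos M\<close> is an immersion, a continuous curve in \<open>M\<close> is piecewise \<open>C\<^sup>1\<close> if and only if its image
  in hyperbolic space is.
\<close>

definition curves :: "('a, 'n::finite, 'z) hypersurface_scheme \<Rightarrow> 'a \<Rightarrow> 'a \<Rightarrow> (real \<Rightarrow> 'a) set" where
  "curves M p q =
     {\<gamma>. pathin (topo M) \<gamma> \<and> \<gamma> 0 = p \<and> \<gamma> 1 = q \<and>
         (pos M \<circ> \<gamma>) piecewise_C1_differentiable_on {0..1}}"

definition curve_length ::
    "('a, 'n::finite, 'z) hypersurface_scheme \<Rightarrow> (real \<Rightarrow> 'a) \<Rightarrow> ennreal" where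
  "curve_length M \<gamma> =
     (\<integral>\<^sup>+t\<in>{0..1}. ennreal (sqrt (lorentz (vector_derivative (pos M \<circ> \<gamma>) (at t))
                                     (vector_derivative (pos M \<circ> \<gamma>) (at t)))) \<partial>lborel)"

text \<open>The distance is \<open>\<infinity>\<close> between different connected components.\<close>

definition riem_dist :: "('a, 'n::finite, 'z) hypersurface_scheme \<Rightarrow> 'a \<Rightarrow> 'a \<Rightarrow> ennreal" where
  "riem_dist M p q = (INF \<gamma> \<in> curves M p q. curve_length M \<gamma>)"

definition complete_hypersurface :: "('a, 'n::finite, 'z) hypersurface_scheme \<Rightarrow> bool" where
  "complete_hypersurface M \<longleftrightarrow>
     (\<forall>s. range s \<subseteq> topspace (topo M) \<longrightarrow>
          (\<forall>\<epsilon>>0. \<exists>N::nat. \<forall>m\<ge>N. \<forall>k\<ge>N. riem_dist M (s m) (s k) < \<epsilon>) \<longrightarrow>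
          (\<exists>p\<in>topspace (topo M). (\<lambda>k. riem_dist M (s k) p) \<longlonglongrightarrow> 0))"

definition complete_minimal_hypersurface :: "('a, 'n::finite, 'z) hypersurface_scheme \<Rightarrow> bool" where
  "complete_minimal_hypersurface M \<longleftrightarrow>
     immersed_hypersurface M \<and> complete_hypersurface M \<and> minimal M"

definition lipschitz_compact_support ::
    "('a, 'n::finite, 'z) hypersurface_scheme \<Rightarrow> ('a \<Rightarrow> real) \<Rightarrow> bool" where
  "lipschitz_compact_support M f \<longleftrightarrow>
     (\<exists>L::real. \<forall>p\<in>topspace (topo M). \<forall>q\<in>topspace (topo M).
        ennreal \<bar>f p - f q\<bar> \<le> ennreal L * riem_dist M p q) \<and>
     compactin (topo M) (topo M closure_of {p \<in> topspace (topo M). f p \<noteq> 0})"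

text \<open>
  Bochner integrals are used wherever all integrands are integrable, which is the case for the
  expressions below since \<open>f\<close> has compact support and bounded gradient.
\<close>

definition sobolev_inequality ::
    "real \<Rightarrow> ('a, 'n::finite, 'z) hypersurface_scheme \<Rightarrow> ('a \<Rightarrow> real) \<Rightarrow> bool" where
  "sobolev_inequality C M f \<longleftrightarrow>
     (LINT p|riem_volume M. \<bar>f p\<bar> powr (2 * real CARD('n) / (real CARD('n) - 2)))
         powr ((real CARD('n) - 2) / real CARD('n))
       \<le> C * (LINT p|riem_volume M. grad_sq M f p)"

definition stable_hypersurface :: "('a, 'n::finite, 'z) hypersurface_scheme \<Rightarrow> bool" where
  "stable_hypersurface M \<longleftrightarrow>
     (\<forall>f. lipschitz_compact_support M f \<longrightarrow>
        (LINT p|riem_volume M. grad_sq M f p - ((normA M p)\<^sup>2 - real CARD('n)) * (f p)\<^sup>2) \<ge> 0)"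

end

theory Submission
  imports Defs
begin

text \<open>
  By Hoelder's inequality with exponents \<open>n/2\<close> and \<open>n/(n-2)\<close>, the Sobolev inequality and the bound on
  \<open>\<integral>|A|\<^sup>n\<close>, the integral of \<open>|A|\<^sup>2 f\<^sup>2\<close> is at most the integral of \<open>|\<nabla>f|\<^sup>2\<close>, and the term \<open>n f\<^sup>2\<close> only
  helps. What takes work is that this computation is about honest integrals: \<open>|A|\<close> is independent
  of the chart and continuous (expand it in an orthonormal frame), the chart volumes agree on
  overlaps, so that compact sets have finite volume, and Lipschitz functions are continuous. The
  measurability of \<open>|\<nabla>f|\<^sup>2\<close> is never needed: either the whole integrand is integrable and \<open>|\<nabla>f|\<^sup>2\<close>
  inherits this from the other terms, or its Bochner integral is \<open>0\<close> by convention.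
\<close>

section \<open>Change of variables\<close>

text \<open>The threshold on the curvature is the one that Hoelder's inequality asks for: its power
  \<open>2 / n\<close> is \<open>1 / Cs\<close>, which cancels the Sobolev constant exactly. Two
  obstacles shape the geometry. The Lorentz form is indefinite, so positivity of the induced metric
  has to be extracted from tangency to the hyperboloid: a boost identifies each tangent space of
  hyperbolic space with a Euclidean space, and orthonormal frames are pulled back from there. A
  transition map carries a frame to a frame with the same vectors in Minkowski space, which makes
  every frame expression independent of the chart. The second obstacle is
  \<open>riem_volume\<close>: a supremum of measures is not the supremum of their values set by set,
  so it is not evaluated directly. A measure with the prescribed restrictions to charts is
  constructed, and \<open>riem_volume_eqI\<close> identifies the two.\<close>

text \<open>
  The change of variables theorem of the library requires the index type of the coordinates to be a
  well-order; an arbitrary finite index type is replaced by the following copy of it.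
\<close>

typedef 'a wellord = "UNIV :: 'a set" ..

lemma bij_Abs_wellord: "bij Abs_wellord"
  by (rule o_bij[of Rep_wellord]) (simp_all add: Abs_wellord_inverse Rep_wellord_inverse fun_eq_iff)

lemma bij_Rep_wellord: "bij Rep_wellord"
  by (rule o_bij[of Abs_wellord]) (simp_all add: Abs_wellord_inverse Rep_wellord_inverse fun_eq_iff)

instance wellord :: (finite) finite
proof
  show "finite (UNIV :: 'a wellord set)"
    by (rule finite_surj[of UNIV _ Abs_wellord]) (simp_all add: bij_is_surj[OF bij_Abs_wellord])
qed

definition wellord_index :: "'a::finite wellord \<Rightarrow> nat" where
  "wellord_index = (SOME f. inj f)"

lemma inj_wellord_index: "inj wellord_index"
proof -
  have "\<exists>f :: 'a wellord \<Rightarrow> nat. inj f"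
    using finite_imp_inj_to_nat_seg[OF finite_class.finite_UNIV] by blast
  then show ?thesis unfolding wellord_index_def by (rule someI_ex)
qed

instantiation wellord :: (finite) wellorder
begin

definition less_eq_wellord :: "'a wellord \<Rightarrow> 'a wellord \<Rightarrow> bool" where
  "x \<le> y \<longleftrightarrow> wellord_index x \<le> wellord_index y"

definition less_wellord :: "'a wellord \<Rightarrow> 'a wellord \<Rightarrow> bool" where
  "x < y \<longleftrightarrow> wellord_index x < wellord_index y"

instance
proof
  fix P :: "'a wellord \<Rightarrow> bool" and a
  assume step: "\<And>x. (\<And>y. y < x \<Longrightarrow> P y) \<Longrightarrow> P x"
  show "P a"
  proof (induction a rule: measure_induct_rule[where f = wellord_index])
    case (less x)
    show ?case by (rule step, rule less) (simp add: less_wellord_def)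
  qed
qed (auto simp: less_eq_wellord_def less_wellord_def dest: injD[OF inj_wellord_index])

end

text \<open>Conjugation by \<open>f\<close> matches the permutations of the two index types in the
  Leibniz formula; it preserves signs and only reorders the factors of each product.\<close>

lemma det_reindex:
  fixes A :: "real^'n^'n" and f :: "'m::finite \<Rightarrow> 'n::finite"
  assumes "bij f"
  shows "det (\<chi> i j. A $ f i $ f j) = det A"
proof -
  let ?conj = "\<lambda>p x. if x \<in> UNIV then f (p (inv f x)) else x"
  have f: "inv f (f x) = x" for x using assms by (simp add: bij_is_inj)
  have s: "sign (?conj p) = sign p" if "p permutes UNIV" for p
  proof -
    interpret permutes_bij_finite p UNIV UNIV f "inv f" "?conj p"
      by unfold_locales (use that assms f in auto)
    show ?thesis by (rule sign_p')
  qed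
  have "det A = (\<Sum>p\<in>{p. p permutes UNIV}. of_int (sign (?conj p)) * (\<Prod>i\<in>UNIV. A $ i $ ?conj p i))"
    unfolding det_def by (rule sum.reindex_bij_betw[OF bij_betw_permutations[OF assms], symmetric])
  also have "\<dots> = (\<Sum>p\<in>{p. p permutes UNIV}. of_int (sign p) * (\<Prod>i\<in>UNIV. A $ f i $ f (p i)))"
  proof (intro sum.cong refl)
    fix p :: "'m \<Rightarrow> 'm" assume "p \<in> {p. p permutes UNIV}"
    then have p: "p permutes UNIV" by simp
    have "(\<Prod>i\<in>UNIV. A $ i $ ?conj p i) = (\<Prod>i\<in>UNIV. A $ f i $ ?conj p (f i))"
      by (rule prod.reindex_bij_betw[OF assms, symmetric])
    then show "of_int (sign (?conj p)) * (\<Prod>i\<in>UNIV. A $ i $ ?conj p i) =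
        of_int (sign p) * (\<Prod>i\<in>UNIV. A $ f i $ f (p i))"
      by (simp only: s[OF p]) (simp add: f)
  qed
  also have "\<dots> = det (\<chi> i j. A $ f i $ f j)" by (simp add: det_def)
  finally show ?thesis ..
qed

definition reindex :: "('m \<Rightarrow> 'n) \<Rightarrow> real^'n \<Rightarrow> real^'m" where
  "reindex f x = (\<chi> i. x $ f i)"

lemma reindex_nth [simp]: "reindex f x $ i = x $ f i"
  by (simp add: reindex_def)

lemma linear_reindex: "linear (reindex f :: real^'n::finite \<Rightarrow> real^'m::finite)"
  by (auto intro!: linearI simp: vec_eq_iff)

lemma reindex_borel [measurable]:
  "(reindex f :: real^'n::finite \<Rightarrow> real^'m::finite) \<in> borel_measurable borel"
  by (intro borel_measurable_continuous_onI linear_continuous_on linear_conv_bounded_linear[THEN iffD1]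
      linear_reindex)

lemma reindex_reindex: "reindex f (reindex g x) = reindex (g \<circ> f) x"
  by (simp add: vec_eq_iff)

lemma reindex_id [simp]: "reindex id x = x"
  by (simp add: vec_eq_iff)

text \<open>Lebesgue measure is determined by its values on boxes, and the preimage of a box under a
  relabelling of coordinates is a box with the same edge lengths in another order.\<close>

lemma distr_lborel_reindex:
  fixes f :: "'m::finite \<Rightarrow> 'n::finite"
  assumes "bij f"
  shows "distr lborel borel (reindex f :: real^'n \<Rightarrow> real^'m) = lborel"
proof (rule lborel_eqI[symmetric])
  fix l u :: "real^'m" assume le: "\<And>b. b \<in> Basis \<Longrightarrow> l \<bullet> b \<le> u \<bullet> b"
  have le': "l $ i \<le> u $ i" for i using le[of "axis i 1"] by (simp add: inner_axis axis_in_Basis_iff)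
  have pr: "(\<Prod>b\<in>Basis. v \<bullet> b) = (\<Prod>i\<in>UNIV. v $ i)" for v :: "real^'k::finite"
  proof -
    have "(\<Prod>b\<in>Basis. v \<bullet> b) = (\<Prod>b\<in>(\<lambda>i. axis i 1) ` UNIV. v \<bullet> b)"
      by (intro prod.cong) (auto simp: Basis_vec_def)
    also have "\<dots> = (\<Prod>i\<in>UNIV. v $ i)"
      by (subst prod.reindex) (auto simp: inj_def axis_eq_axis inner_axis)
    finally show ?thesis .
  qed
  have f: "f (inv f x) = x" "inv f (f y) = y" for x y
    using assms by (simp_all add: bij_is_surj surj_f_inv_f bij_is_inj)
  have "reindex f -` box l u = box (reindex (inv f) l) (reindex (inv f) u)"
    using f by (auto simp: mem_box_cart) (metis f)+
  then have "emeasure (distr lborel borel (reindex f)) (box l u)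
      = emeasure lborel (box (reindex (inv f) l) (reindex (inv f) u))"
    by (subst emeasure_distr) auto
  also have "\<dots> = ennreal (\<Prod>b\<in>Basis. (reindex (inv f) u - reindex (inv f) l) \<bullet> b)"
    by (rule emeasure_lborel_box) (auto simp: Basis_vec_def inner_axis le')
  also have "(\<Prod>b\<in>Basis. (reindex (inv f) u - reindex (inv f) l) \<bullet> b) = (\<Prod>i\<in>UNIV. (u - l) $ inv f i)"
    by (subst pr) simp
  also have "\<dots> = (\<Prod>i\<in>UNIV. (u - l) $ i)"
    using prod.reindex_bij_betw[OF bij_imp_bij_inv[OF assms], of "\<lambda>i. (u - l) $ i"] by simp
  finally show "emeasure (distr lborel borel (reindex f)) (box l u) = ennreal (\<Prod>b\<in>Basis. (u - l) \<bullet> b)"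
    by (simp add: pr)
qed simp

lemma nn_integral_reindex:
  fixes f :: "'m::finite \<Rightarrow> 'n::finite"
  assumes "bij f" "F \<in> borel_measurable borel"
  shows "(\<integral>\<^sup>+x. F (reindex f x) \<partial>lborel) = (\<integral>\<^sup>+y. F y \<partial>lborel)"
  by (subst distr_lborel_reindex[OF assms(1), symmetric], subst nn_integral_distr) (use assms(2) in auto)

text \<open>A bridge between two notions of integral: for nonnegative functions, absolute
  integrability together with the value of the gauge integral carries the same information as the
  nonnegative integral, with failure of integrability read as \<open>\<infinity>\<close>.\<close>

lemma nn_integral_eq_absolutely_integrable:
  fixes h :: "'b::euclidean_space \<Rightarrow> real"
  assumes nonneg: "\<And>x. x \<in> S \<Longrightarrow> 0 \<le> h x"
    and meas: "(\<lambda>x. indicator S x * h x) \<in> borel_measurable borel"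
  shows "(\<integral>\<^sup>+x. ennreal (indicator S x * h x) \<partial>lborel) =
           (if h absolutely_integrable_on S then ennreal (integral S h) else \<infinity>)"
proof (cases "h absolutely_integrable_on S")
  case True
  then have "(h has_integral integral S h) S"
    using set_lebesgue_integral_eq_integral(1) by (auto intro: integrable_integral)
  from nn_integral_has_integral_lebesgue[OF nonneg this] True show ?thesis by simp
next
  case False
  have "(\<integral>\<^sup>+x. ennreal (indicator S x * h x) \<partial>lborel) = \<infinity>"
  proof (rule ccontr)
    assume "(\<integral>\<^sup>+x. ennreal (indicator S x * h x) \<partial>lborel) \<noteq> \<infinity>"
    then have "integrable lborel (\<lambda>x. indicator S x * h x)"
      using meas nonneg
      by (intro integrableI_nonneg) (auto simp: indicator_def less_top)
    then have "integrable lebesgue (\<lambda>x. indicator S x *\<^sub>R h x)"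
      by (subst integrable_completion) (use meas in auto)
    with False show False by (simp add: set_integrable_def)
  qed
  with False show ?thesis by simp
qed

text \<open>Integrability on one side is equivalent to integrability on the other, with equal
  values; if it fails, both nonnegative integrals are infinite.\<close>

lemma nn_integral_change_of_variables_wellorder:
  fixes \<tau> :: "real^'m::{finite,wellorder} \<Rightarrow> real^'m::_" and h :: "real^'m::_ \<Rightarrow> real"
  assumes A: "A \<in> sets borel"
    and der: "\<And>x. x \<in> A \<Longrightarrow> (\<tau> has_derivative \<tau>' x) (at x within A)"
    and inj: "inj_on \<tau> A"
    and nonneg: "\<And>y. y \<in> \<tau> ` A \<Longrightarrow> 0 \<le> h y"
    and m1: "(\<lambda>y. indicator (\<tau> ` A) y * h y) \<in> borel_measurable borel"
    and m2: "(\<lambda>x. indicator A x * (\<bar>det (matrix (\<tau>' x))\<bar> * h (\<tau> x))) \<in> borel_measurable borel"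
  shows "(\<integral>\<^sup>+y. ennreal (indicator (\<tau> ` A) y * h y) \<partial>lborel) =
         (\<integral>\<^sup>+x. ennreal (indicator A x * (\<bar>det (matrix (\<tau>' x))\<bar> * h (\<tau> x))) \<partial>lborel)"
proof -
  have "A \<in> sets lebesgue" using A by (simp add: sets_completionI_sets)
  note cov = has_absolute_integral_change_of_variables[OF this der inj, where f = "\<lambda>y. vec (h y) :: real^1"]
  have v: "c *\<^sub>R (vec r :: real^1) = vec (c * r)" for c r by (simp add: vec_eq_iff)
  \<comment> \<open>The substitution theorem concerns vector-valued functions, hence the detour
    through \<open>real^1\<close>. Because the equivalence holds for every \<open>b\<close>, it
    transfers integrability and the value at once.\<close>
  have cov': "(\<lambda>x. \<bar>det (matrix (\<tau>' x))\<bar> * h (\<tau> x)) absolutely_integrable_on A \<and>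
      integral A (\<lambda>x. \<bar>det (matrix (\<tau>' x))\<bar> * h (\<tau> x)) = b \<longleftrightarrow>
      h absolutely_integrable_on \<tau> ` A \<and> integral (\<tau> ` A) h = b" for b
  proof -
    have i: "integral S (\<lambda>x. vec (k x) :: real^1) = vec c \<longleftrightarrow> integral S k = c"
      for S :: "(real^'m::{finite,wellorder}) set" and k c
      by (simp add: integral_on_1_eq vec_eq_iff)
    have a: "(\<lambda>x. vec (k x) :: real^1) absolutely_integrable_on S \<longleftrightarrow> k absolutely_integrable_on S"
      for S :: "(real^'m::{finite,wellorder}) set" and k
      by (simp add: absolutely_integrable_on_1_iff)
    show ?thesis using cov[of "vec b"] unfolding v i a .
  qed
  have nn2: "0 \<le> \<bar>det (matrix (\<tau>' x))\<bar> * h (\<tau> x)" if "x \<in> A" for x using nonneg that by simp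
  have e1: "(\<integral>\<^sup>+y. ennreal (indicator (\<tau> ` A) y * h y) \<partial>lborel) =
      (if h absolutely_integrable_on \<tau> ` A then ennreal (integral (\<tau> ` A) h) else \<infinity>)"
    by (rule nn_integral_eq_absolutely_integrable[OF nonneg m1])
  have e2: "(\<integral>\<^sup>+x. ennreal (indicator A x * (\<bar>det (matrix (\<tau>' x))\<bar> * h (\<tau> x))) \<partial>lborel) =
      (if (\<lambda>x. \<bar>det (matrix (\<tau>' x))\<bar> * h (\<tau> x)) absolutely_integrable_on A
       then ennreal (integral A (\<lambda>x. \<bar>det (matrix (\<tau>' x))\<bar> * h (\<tau> x))) else \<infinity>)"
    by (rule nn_integral_eq_absolutely_integrable[OF nn2 m2])
  show ?thesis
  proof (cases "h absolutely_integrable_on \<tau> ` A")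
    case True
    then show ?thesis using cov'[of "integral (\<tau> ` A) h"] unfolding e1 e2 by presburger
  next
    case False
    then have "\<not> (\<lambda>x. \<bar>det (matrix (\<tau>' x))\<bar> * h (\<tau> x)) absolutely_integrable_on A"
      using cov' by blast
    with False show ?thesis unfolding e1 e2 by presburger
  qed
qed

text \<open>Conjugating \<open>\<tau>\<close> with the mutually inverse relabellings
  \<open>r\<close> and \<open>s\<close> moves the problem to the well-ordered copy of the index
  type. Jacobian determinants survive by \<open>det_reindex\<close>, integrals by
  \<open>nn_integral_reindex\<close>.\<close>

lemma nn_integral_change_of_variables:
  fixes \<tau> :: "real^'n::finite \<Rightarrow> real^'n" and h :: "real^'n \<Rightarrow> real"
  assumes A: "A \<in> sets borel"
    and der: "\<And>x. x \<in> A \<Longrightarrow> (\<tau> has_derivative \<tau>' x) (at x within A)"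
    and inj: "inj_on \<tau> A"
    and nonneg: "\<And>y. y \<in> \<tau> ` A \<Longrightarrow> 0 \<le> h y"
    and m1: "(\<lambda>y. indicator (\<tau> ` A) y * h y) \<in> borel_measurable borel"
    and m2: "(\<lambda>x. indicator A x * (\<bar>det (matrix (\<tau>' x))\<bar> * h (\<tau> x))) \<in> borel_measurable borel"
  shows "(\<integral>\<^sup>+y. ennreal (indicator (\<tau> ` A) y * h y) \<partial>lborel) =
         (\<integral>\<^sup>+x. ennreal (indicator A x * (\<bar>det (matrix (\<tau>' x))\<bar> * h (\<tau> x))) \<partial>lborel)"
proof -
  define r where "r = (reindex Rep_wellord :: real^'n \<Rightarrow> real^'n wellord)"
  define s where "s = (reindex Abs_wellord :: real^'n wellord \<Rightarrow> real^'n)"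
  have RA: "Rep_wellord \<circ> Abs_wellord = (id :: 'n \<Rightarrow> 'n)" "Abs_wellord \<circ> Rep_wellord = (id :: 'n wellord \<Rightarrow> _)"
    by (auto simp: Abs_wellord_inverse Rep_wellord_inverse)
  have rs [simp]: "r (s y) = y" and sr [simp]: "s (r x) = x" for x y
    by (simp_all add: r_def s_def reindex_reindex RA)
  have lin: "linear r" "linear s" by (simp_all add: r_def s_def linear_reindex)
  have [measurable]: "r \<in> borel_measurable borel" "s \<in> borel_measurable borel"
    by (simp_all add: r_def s_def)
  define \<sigma> where "\<sigma> = r \<circ> \<tau> \<circ> s"
  define \<sigma>' where "\<sigma>' y = r \<circ> \<tau>' (s y) \<circ> s" for y
  define B where "B = s -` A"
  have B: "B \<in> sets borel"
    using measurable_sets[of s borel borel A] A by (simp add: B_def)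
  have Br: "B = r ` A" unfolding B_def by (auto simp: image_iff) (metis rs)
  have sB: "s ` B = A" unfolding Br by (simp add: image_image)
  have sb: "s y \<in> A \<longleftrightarrow> y \<in> B" for y by (simp add: B_def)
  have \<sigma>B: "\<sigma> ` B = s -` (\<tau> ` A)"
    unfolding \<sigma>_def Br by (auto simp: image_iff) (metis rs)
  have der\<sigma>: "(\<sigma> has_derivative \<sigma>' y) (at y within B)" if "y \<in> B" for y
  proof -
    have 1: "(s has_derivative s) (at y within B)" "(r has_derivative r) (at z within Z)" for z Z
      using lin by (simp_all add: linear_imp_has_derivative)
    have "(\<tau> has_derivative \<tau>' (s y)) (at (s y) within s ` B)"
      using der[of "s y"] that sb sB by simp
    from diff_chain_within[OF diff_chain_within[OF 1(1) this] 1(2)]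
    show ?thesis by (simp add: \<sigma>_def \<sigma>'_def o_assoc)
  qed
  have inj\<sigma>: "inj_on \<sigma> B"
  proof (rule inj_onI)
    fix x y assume "x \<in> B" "y \<in> B" "\<sigma> x = \<sigma> y"
    then have "s (r (\<tau> (s x))) = s (r (\<tau> (s y)))" "s x \<in> A" "s y \<in> A"
      unfolding \<sigma>_def comp_apply sb by simp_all
    then have "s x = s y" using inj_onD[OF inj, of "s x" "s y"] unfolding sr by blast
    then show "x = y" by (metis rs)
  qed
  have det: "det (matrix (\<sigma>' y)) = det (matrix (\<tau>' (s y)))" for y
  proof -
    have "s (axis i 1) = axis (Rep_wellord i) 1" for i
      by (auto simp: s_def vec_eq_iff axis_def Abs_wellord_inverse Rep_wellord_inverse)
    then have "matrix (\<sigma>' y) = (\<chi> i j. matrix (\<tau>' (s y)) $ Rep_wellord i $ Rep_wellord j)"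
      by (simp add: matrix_def vec_eq_iff[of "_ :: (_^_)^_"] vec_eq_iff[of "_ :: real^_ wellord"] \<sigma>'_def r_def)
    then show ?thesis by (simp add: det_reindex[OF bij_Rep_wellord])
  qed
  have i1: "indicator (\<sigma> ` B) y = (indicator (\<tau> ` A) (s y) :: real)" for y
    by (simp add: \<sigma>B indicator_def)
  have i2: "indicator B y = (indicator A (s y) :: real)" for y
    by (simp add: sb indicator_def)
  have *: "(\<integral>\<^sup>+y. ennreal (indicator (\<sigma> ` B) y * h (s y)) \<partial>lborel) =
         (\<integral>\<^sup>+x. ennreal (indicator B x * (\<bar>det (matrix (\<sigma>' x))\<bar> * h (s (\<sigma> x)))) \<partial>lborel)"
  proof (rule nn_integral_change_of_variables_wellorder[OF B der\<sigma> inj\<sigma>])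
    show "(\<lambda>y. indicator (\<sigma> ` B) y * h (s y)) \<in> borel_measurable borel"
      unfolding i1 by (rule measurable_compose[OF _ m1]) simp
    have "(\<lambda>x. indicator A (s x) * (\<bar>det (matrix (\<tau>' (s x)))\<bar> * h (\<tau> (s x)))) \<in> borel_measurable borel"
      by (rule measurable_compose[OF _ m2]) simp
    then show "(\<lambda>x. indicator B x * (\<bar>det (matrix (\<sigma>' x))\<bar> * h (s (\<sigma> x)))) \<in> borel_measurable borel"
      unfolding i2 det by (simp add: \<sigma>_def)
  qed (use nonneg \<sigma>B in auto)
  have "(\<integral>\<^sup>+y. ennreal (indicator (\<tau> ` A) (s y) * h (s y)) \<partial>lborel) =
      (\<integral>\<^sup>+y. ennreal (indicator (\<tau> ` A) y * h y) \<partial>lborel)"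
    unfolding s_def by (rule nn_integral_reindex[OF bij_Abs_wellord]) (use m1 in auto)
  moreover have "(\<integral>\<^sup>+x. ennreal (indicator A (s x) * (\<bar>det (matrix (\<tau>' (s x)))\<bar> * h (\<tau> (s x)))) \<partial>lborel)
     = (\<integral>\<^sup>+x. ennreal (indicator A x * (\<bar>det (matrix (\<tau>' x))\<bar> * h (\<tau> x))) \<partial>lborel)"
    unfolding s_def by (rule nn_integral_reindex[OF bij_Abs_wellord]) (use m2 in auto)
  ultimately show ?thesis
    using * unfolding i1 i2 det by (simp add: \<sigma>_def)
qed


section \<open>Local geometry of immersions\<close>

lemma bounded_bilinear_lorentz: "bounded_bilinear (lorentz :: 'n::finite minkowski \<Rightarrow> _)"
  unfolding bilinear_conv_bounded_bilinear[symmetric] bilinear_def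
  by (auto intro!: linearI simp: lorentz_def algebra_simps inner_simps)

interpretation lorentz: bounded_bilinear "lorentz :: 'n::finite minkowski \<Rightarrow> _"
  by (rule bounded_bilinear_lorentz)

lemma lorentz_commute: "lorentz v w = lorentz w v"
  by (simp add: lorentz_def inner_commute)

text \<open>Only the sign of the timelike square differs from the Euclidean norm. The bound lets
  Euclidean estimates of a velocity control the length of a curve.\<close>

lemma lorentz_le_norm_sq: "lorentz w w \<le> (norm w)\<^sup>2"
  by (cases w) (simp add: lorentz_def norm_Pair dot_square_norm power2_eq_square[symmetric])

lemma lorentz_hyp_proj: "z \<in> hyperbolic_space \<Longrightarrow> lorentz (hyp_proj z w) z = 0"
  by (simp add: hyp_proj_def lorentz.add_left lorentz.scaleR_left hyperbolic_space_def)

lemma linear_hyp_proj: "linear (hyp_proj z)"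
  by (rule linearI) (simp_all add: hyp_proj_def lorentz.add_left lorentz.scaleR_left algebra_simps)

text \<open>
  The Lorentz boost that moves \<open>z\<close> to the base point of the hyperboloid, followed by dropping the
  last coordinate, which vanishes on the image of the tangent space at \<open>z\<close>.
\<close>

definition boost :: "'n::finite minkowski \<Rightarrow> 'n minkowski \<Rightarrow> (real^'n) \<times> real" where
  "boost z w = fst w - (snd w / (1 + snd z)) *\<^sub>R fst z"

lemma linear_boost: "linear (boost z)"
  by (auto intro!: linearI simp: boost_def algebra_simps add_divide_distrib)

text \<open>This is why tangent vectors of hyperbolic space see a Euclidean inner product although
  the Lorentz form is indefinite. The equation of the hyperboloid gives the square of the spatial
  part of \<open>z\<close>, tangency gives its products with the spatial parts of \<open>v\<close>
  and \<open>w\<close>, and the rest is algebra.\<close>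

lemma inner_boost:
  assumes z: "z \<in> hyperbolic_space" and "lorentz v z = 0" "lorentz w z = 0"
  shows "boost z v \<bullet> boost z w = lorentz v w"
proof -
  obtain p t where zt: "z = (p, t)" by (cases z)
  obtain a s where v: "v = (a, s)" by (cases v)
  obtain b r where w: "w = (b, r)" by (cases w)
  have t: "t > 0" "p \<bullet> p = t * t - 1" "a \<bullet> p = s * t" "b \<bullet> p = r * t"
    using assms by (auto simp: zt v w hyperbolic_space_def lorentz_def)
  have "boost z v \<bullet> boost z w = (a - (s / (1 + t)) *\<^sub>R p) \<bullet> (b - (r / (1 + t)) *\<^sub>R p)"
    by (simp add: boost_def zt v w)
  also have "\<dots> = a \<bullet> b - (r / (1 + t)) * (a \<bullet> p) - (s / (1 + t)) * (b \<bullet> p)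
      + (s / (1 + t)) * (r / (1 + t)) * (p \<bullet> p)"
    by (simp add: inner_diff_left inner_diff_right inner_commute algebra_simps)
  also have "\<dots> = a \<bullet> b - s * r"
  \<comment> \<open>The correction terms add up to \<open>s * r\<close>, because their common
    numerator factor is \<open>(1 + t) * (1 + t)\<close> and cancels the denominator.\<close>
  proof -
    have "(r / (1 + t)) * (s * t) + (s / (1 + t)) * (r * t) - (s / (1 + t)) * (r / (1 + t)) * (t * t - 1)
        = s * r * (2 * t * (1 + t) - (t * t - 1)) / ((1 + t) * (1 + t))"
      using t(1) by (simp add: divide_simps) (simp add: algebra_simps)
    also have "2 * t * (1 + t) - (t * t - 1) = (1 + t) * (1 + t)" by (simp add: algebra_simps)
    finally show ?thesis using t by simp
  qed
  finally show ?thesis by (simp add: lorentz_def v w)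
qed

lemma lorentz_tangent_nonneg:
  assumes "z \<in> hyperbolic_space" "lorentz w z = 0"
  shows "0 \<le> lorentz w w"
  using inner_boost[OF assms(1) assms(2) assms(2)] by (metis inner_ge_zero)

section \<open>Calculus with coordinate partial derivatives\<close>

lemma smooth_onD:
  assumes "smooth_on U f"
  shows "continuous_on U f"
    and "x \<in> U \<Longrightarrow> f differentiable (at x)"
    and "smooth_on U (partial_deriv f i)"
proof -
  have k: "Ck_on k U f" for k using assms by (simp add: smooth_on_def)
  show "continuous_on U f" using k[of 0] by simp
  show "x \<in> U \<Longrightarrow> f differentiable (at x)" using k[of "Suc 0"] by simp
  have "Ck_on k U (partial_deriv f i)" for k using k[of "Suc k"] by simp
  then show "smooth_on U (partial_deriv f i)" by (simp add: smooth_on_def)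
qed

lemma frechet_derivative_eq_sum:
  fixes f :: "real^'n::finite \<Rightarrow> 'b::real_normed_vector"
  assumes "f differentiable (at x)"
  shows "frechet_derivative f (at x) u = (\<Sum>i\<in>UNIV. u $ i *\<^sub>R partial_deriv f i x)"
proof -
  have l: "linear (frechet_derivative f (at x))" by (rule linear_frechet_derivative[OF assms])
  have "frechet_derivative f (at x) u = frechet_derivative f (at x) (\<Sum>i\<in>UNIV. u $ i *\<^sub>R axis i 1)"
    by (simp add: basis_expansion scalar_mult_eq_scaleR[symmetric])
  then show ?thesis
    by (simp add: linear_sum[OF l] linear_scale[OF l] partial_deriv_def)
qed

lemma partial_deriv_eqI: "(f has_derivative f') (at x) \<Longrightarrow> partial_deriv f i x = f' (axis i 1)"
  unfolding partial_deriv_def by (metis frechet_derivative_at)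

lemma partial_deriv_cong_open:
  assumes "open S" "x \<in> S" "\<And>y. y \<in> S \<Longrightarrow> f y = g y" "g differentiable (at x)"
  shows "partial_deriv f i x = partial_deriv g i x"
proof -
  have "(g has_derivative frechet_derivative g (at x)) (at x)"
    using assms(4) frechet_derivative_works by blast
  then have "(f has_derivative frechet_derivative g (at x)) (at x)"
    by (rule has_derivative_transform_within_open[OF _ assms(1,2)]) (simp add: assms(3))
  from partial_deriv_eqI[OF this] show ?thesis by (simp add: partial_deriv_def)
qed

section \<open>Normal projection, second fundamental form and orthonormal frames\<close>

lemma linear_tangent_proj: "linear (tangent_proj X x)"
  unfolding tangent_proj_def
  by (intro linear_compose_sum ballI linearI)
     (simp_all add: lorentz.add_left lorentz.scaleR_left algebra_simps)

text \<open>Both projections in the second fundamental form are merged into one linear map on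
  Minkowski space. It can then be applied term by term to a chain-rule expansion of the second
  derivatives of \<open>X\<close>.\<close>

definition normal_proj ::
    "(real^'n::finite \<Rightarrow> 'n minkowski) \<Rightarrow> real^'n \<Rightarrow> 'n minkowski \<Rightarrow> 'n minkowski" where
  "normal_proj X x w = hyp_proj (X x) w - tangent_proj X x (hyp_proj (X x) w)"

lemma linear_normal_proj: "linear (normal_proj X x)"
  unfolding normal_proj_def
  by (intro linear_compose_sub linear_hyp_proj linear_compose[OF linear_hyp_proj linear_tangent_proj, unfolded o_def])

lemma second_ff_eq: "second_ff X i j x = normal_proj X x (partial_deriv (partial_deriv X j) i x)"
  by (simp add: second_ff_def normal_proj_def hyp_connection_def)

text \<open>The bilinear form with coefficients \<open>second_ff\<close>. In contrast to the
  coefficients, it can be evaluated on a frame and transforms by mere substitution.\<close>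

definition second_ff_form ::
    "(real^'n::finite \<Rightarrow> 'n minkowski) \<Rightarrow> real^'n \<Rightarrow> real^'n \<Rightarrow> real^'n \<Rightarrow> 'n minkowski" where
  "second_ff_form X x u v = (\<Sum>i\<in>UNIV. \<Sum>j\<in>UNIV. (u $ i * v $ j) *\<^sub>R second_ff X i j x)"

lemma bilinear_second_ff_form: "bilinear (second_ff_form X x)"
  unfolding bilinear_def second_ff_form_def
  by (auto intro!: linear_compose_sum linearI simp: algebra_simps)

lemma matrix_inv_unique:
  assumes "A ** B = mat 1" "B ** A = mat 1"
  shows "matrix_inv A = B"
proof -
  have "A ** matrix_inv A = mat 1 \<and> matrix_inv A ** A = mat 1"
    unfolding matrix_inv_def by (rule someI[of _ B]) (use assms in simp)
  then show ?thesis using assms by (metis matrix_mul_assoc matrix_mul_lid matrix_mul_rid)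
qed

lemma matrix_inv_right: "invertible A \<Longrightarrow> A ** matrix_inv A = mat 1"
  using matrix_inv_unique by (metis invertible_def)

text \<open>The frame lives in the coordinate domain, so that it can be pushed forward by transition
  maps. Indexing by \<open>'n\<close> makes its coordinate matrix square.\<close>

definition orthonormal_frame ::
    "(real^'n::finite \<Rightarrow> 'n minkowski) \<Rightarrow> real^'n \<Rightarrow> ('n \<Rightarrow> real^'n) \<Rightarrow> bool" where
  "orthonormal_frame X x E \<longleftrightarrow>
     (\<forall>a b. lorentz (frechet_derivative X (at x) (E a)) (frechet_derivative X (at x) (E b))
        = (if a = b then 1 else 0))"

text \<open>Here \<open>M\<close> has the frame vectors as columns, and orthonormality says
  \<open>transpose M ** g ** M = mat 1\<close> for the metric \<open>g\<close>. One-sided inverses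
  of square matrices are two-sided, which yields the inverse metric; determinants yield the last
  claim.\<close>

lemma orthonormal_frame_metric:
  fixes X :: "real^'n::finite \<Rightarrow> 'n minkowski"
  assumes X: "X differentiable (at x)" and E: "orthonormal_frame X x E"
  defines "M \<equiv> (\<chi> i a. E a $ i)"
  shows "matrix_inv (induced_metric X x) = M ** transpose M"
    and "induced_metric X x ** inv_metric X x = mat 1"
    and "det (induced_metric X x) * (det M)\<^sup>2 = 1"
proof -
  let ?g = "induced_metric X x"
  have "(transpose M ** ?g) ** M = mat 1"
  proof -
    have "((transpose M ** ?g) ** M) $ a $ b =
        lorentz (frechet_derivative X (at x) (E a)) (frechet_derivative X (at x) (E b))" for a b
      unfolding frechet_derivative_eq_sum[OF X] lorentz.sum_left lorentz.sum_right
        lorentz.scaleR_left lorentz.scaleR_right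
      by (simp add: matrix_matrix_mult_def transpose_def M_def induced_metric_def sum_distrib_left
          sum_distrib_right mult_ac)
    then show ?thesis using E by (simp add: vec_eq_iff orthonormal_frame_def mat_def)
  qed
  note m = this
  then have "M ** (transpose M ** ?g) = mat 1" by (metis matrix_left_right_inverse)
  then have 1: "(M ** transpose M) ** ?g = mat 1" by (simp add: matrix_mul_assoc)
  then have 2: "?g ** (M ** transpose M) = mat 1" by (metis matrix_left_right_inverse)
  show 3: "matrix_inv ?g = M ** transpose M" using matrix_inv_unique[OF 2 1] .
  show "?g ** inv_metric X x = mat 1" using 2 3 by simp
  from arg_cong[OF m, of det] show "det ?g * (det M)\<^sup>2 = 1"
    by (simp add: det_mul det_transpose power2_eq_square mult_ac)
qed

lemma orthonormal_frame_inv_metric: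
  fixes X :: "real^'n::finite \<Rightarrow> 'n minkowski"
  assumes "X differentiable (at x)" "orthonormal_frame X x E"
  shows "inv_metric X x $ i $ j = (\<Sum>a\<in>UNIV. E a $ i * E a $ j)"
  using orthonormal_frame_metric(1)[OF assms]
  by (simp add: matrix_matrix_mult_def transpose_def)

text \<open>Only the images of the frame in Minkowski space occur on the right, so any two
  parametrizations with the same frame images have the same projection.\<close>

lemma tangent_proj_frame:
  fixes X :: "real^'n::finite \<Rightarrow> 'n minkowski"
  assumes X: "X differentiable (at x)" and E: "orthonormal_frame X x E"
  shows "tangent_proj X x w =
    (\<Sum>a\<in>UNIV. lorentz w (frechet_derivative X (at x) (E a)) *\<^sub>R frechet_derivative X (at x) (E a))"
proof -
  have "tangent_proj X x w = (\<Sum>k\<in>UNIV. \<Sum>l\<in>UNIV. \<Sum>a\<in>UNIV.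
      (E a $ k * lorentz w (partial_deriv X k x) * E a $ l) *\<^sub>R partial_deriv X l x)"
    unfolding tangent_proj_def orthonormal_frame_inv_metric[OF X E]
    by (simp add: sum_distrib_left sum_distrib_right scaleR_sum_left mult_ac)
  also have "\<dots> = (\<Sum>k\<in>UNIV. \<Sum>a\<in>UNIV. \<Sum>l\<in>UNIV.
      (E a $ k * lorentz w (partial_deriv X k x) * E a $ l) *\<^sub>R partial_deriv X l x)"
    by (intro sum.cong refl sum.swap)
  also have "\<dots> = (\<Sum>a\<in>UNIV. \<Sum>k\<in>UNIV. \<Sum>l\<in>UNIV.
      (E a $ k * lorentz w (partial_deriv X k x) * E a $ l) *\<^sub>R partial_deriv X l x)"
    by (rule sum.swap)
  also have "\<dots> = (\<Sum>a\<in>UNIV. lorentz w (frechet_derivative X (at x) (E a)) *\<^sub>R frechet_derivative X (at x) (E a))"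
    unfolding frechet_derivative_eq_sum[OF X] lorentz.sum_right lorentz.scaleR_right
    by (simp add: scaleR_sum_left scaleR_sum_right sum_distrib_right) (intro sum.cong refl sum.swap)
  finally show ?thesis .
qed

text \<open>Substituting the frame expression of the inverse metric removes all metric coefficients.
  What remains is a sum of Lorentz squares, which serves both chart independence and
  positivity.\<close>

lemma second_ff_sq_frame:
  fixes X :: "real^'n::finite \<Rightarrow> 'n minkowski"
  assumes X: "X differentiable (at x)" and E: "orthonormal_frame X x E"
  shows "second_ff_sq X x =
    (\<Sum>a\<in>UNIV. \<Sum>b\<in>UNIV. lorentz (second_ff_form X x (E a) (E b)) (second_ff_form X x (E a) (E b)))"
proof -
  have sum_product_mult: "sum p UNIV * sum q UNIV * c = (\<Sum>a\<in>UNIV. \<Sum>b\<in>UNIV. p a * q b * c)"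
    for p q :: "'n \<Rightarrow> real" and c
    by (subst sum_product) (simp add: sum_distrib_right)
  let ?h = "\<lambda>i j. second_ff X i j x"
  let ?t = "\<lambda>a b i j k l. E a $ i * E b $ j * E a $ k * E b $ l * lorentz (?h i j) (?h k l)"
  let ?S = "\<lambda>f. sum f (UNIV :: 'n set)"
  have "second_ff_sq X x = ?S (\<lambda>i. ?S (\<lambda>j. ?S (\<lambda>k. ?S (\<lambda>l. ?S (\<lambda>a. ?S (\<lambda>b. ?t a b i j k l))))))"
    unfolding second_ff_sq_def orthonormal_frame_inv_metric[OF X E] sum_product_mult
    by (simp add: mult_ac)
  \<comment> \<open>As a single sum over sextuples, moving the frame indices \<open>a\<close>,
    \<open>b\<close> outward is one bijection instead of a chain of exchanges of neighbouring
    sums.\<close>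
  also have "\<dots> = (\<Sum>(i,j,k,l,a,b)\<in>UNIV. ?t a b i j k l)"
    by (simp add: sum.cartesian_product UNIV_Times_UNIV[symmetric] del: UNIV_Times_UNIV)
  also have "\<dots> = (\<Sum>(a,b,i,j,k,l)\<in>UNIV. ?t a b i j k l)"
    by (rule sum.reindex_bij_witness[where i = "\<lambda>(a,b,i,j,k,l). (i,j,k,l,a,b)" and j = "\<lambda>(i,j,k,l,a,b). (a,b,i,j,k,l)"]) auto
  also have "\<dots> = ?S (\<lambda>a. ?S (\<lambda>b. ?S (\<lambda>i. ?S (\<lambda>j. ?S (\<lambda>k. ?S (\<lambda>l. ?t a b i j k l))))))"
    by (simp add: sum.cartesian_product UNIV_Times_UNIV[symmetric] del: UNIV_Times_UNIV)
  also have "\<dots> = (\<Sum>a\<in>UNIV. \<Sum>b\<in>UNIV. lorentz (second_ff_form X x (E a) (E b)) (second_ff_form X x (E a) (E b)))"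
    unfolding second_ff_form_def
    unfolding lorentz.sum_left lorentz.scaleR_left
    unfolding lorentz.sum_right lorentz.scaleR_right
    by (simp add: sum_distrib_left mult_ac)
  finally show ?thesis .
qed

text \<open>Cramer's rule for the columns of the inverse. It exhibits the entries as quotients of
  polynomials in the entries of \<open>A\<close>, from which continuity of the inverse metric is
  read off.\<close>

lemma matrix_inv_nth:
  fixes A :: "real^'n^'n::finite"
  assumes "invertible A"
  shows "matrix_inv A $ k $ l = det (\<chi> i j. if j = k then axis l 1 $ i else A $ i $ j) / det A"
proof -
  have "A ** matrix_inv A = mat 1"
    by (rule matrix_inv_right[OF assms])
  then have "A *v column l (matrix_inv A) = axis l 1"
    by (metis matrix_vector_mul_assoc matrix_vector_mul_lid matrix_vector_mult_basis)
  moreover have "det A \<noteq> 0" using assms invertible_det_nz by blast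
  ultimately have "column l (matrix_inv A) = (\<chi> k. det (\<chi> i j. if j = k then axis l 1 $ i else A $ i $ j) / det A)"
    by (simp add: cramer)
  from arg_cong[OF this, of "\<lambda>v. v $ k"] show ?thesis by (simp add: column_def)
qed

section \<open>Pointwise geometry and continuity in a single chart\<close>

locale immersed_patch =
  fixes U :: "(real^'n::finite) set" and X :: "real^'n \<Rightarrow> 'n minkowski"
  assumes open_dom: "open U"
    and smooth: "smooth_on U X"
    and hyperbolic: "x \<in> U \<Longrightarrow> X x \<in> hyperbolic_space"
    and injective: "x \<in> U \<Longrightarrow> inj (frechet_derivative X (at x))"
begin

lemma differentiable: "x \<in> U \<Longrightarrow> X differentiable (at x)"
  by (rule smooth_onD(2)[OF smooth])

lemma has_derivative: "x \<in> U \<Longrightarrow> (X has_derivative frechet_derivative X (at x)) (at x)"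
  using differentiable frechet_derivative_works by blast

text \<open>Differentiate the constant function \<open>lorentz (X y) (X y) = -1\<close>.\<close>

lemma lorentz_deriv_pos:
  assumes "x \<in> U"
  shows "lorentz (frechet_derivative X (at x) u) (X x) = 0"
proof -
  note d = has_derivative[OF assms]
  have "((\<lambda>y. lorentz (X y) (X y)) has_derivative
      (\<lambda>h. lorentz (X x) (frechet_derivative X (at x) h) + lorentz (frechet_derivative X (at x) h) (X x))) (at x)"
    by (rule lorentz.FDERIV[OF d d])
  moreover have "((\<lambda>y. lorentz (X y) (X y)) has_derivative (\<lambda>h. 0)) (at x)"
    by (rule has_derivative_transform_within_open[OF has_derivative_const[of "-1"] open_dom assms])
       (use hyperbolic in \<open>auto simp: hyperbolic_space_def\<close>)
  ultimately have "(\<lambda>h. lorentz (X x) (frechet_derivative X (at x) h) + lorentz (frechet_derivative X (at x) h) (X x)) = (\<lambda>h. 0)"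
    by (rule has_derivative_unique)
  from fun_cong[OF this, of u] show ?thesis by (simp add: lorentz_commute)
qed

text \<open>The derivative of \<open>X\<close> followed by the boost is an injective linear map into
  a Euclidean space that turns the Lorentz form into the inner product. An orthonormal basis of its
  range is pulled back to the coordinate domain.\<close>

lemma orthonormal_frame_exists:
  assumes x: "x \<in> U"
  shows "\<exists>E. orthonormal_frame X x E"
proof -
  let ?D = "frechet_derivative X (at x)"
  let ?T = "\<lambda>u. boost (X x) (?D u)"
  have linD: "linear ?D" by (rule linear_frechet_derivative[OF differentiable[OF x]])
  have linT: "linear ?T"
    using linear_compose[OF linD linear_boost] by (simp add: o_def)
  have inner: "?T u \<bullet> ?T v = lorentz (?D u) (?D v)" for u v
    by (rule inner_boost[OF hyperbolic[OF x]]) (simp_all add: lorentz_deriv_pos x)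
  have "inj ?T"
  proof (subst linear_injective_0[OF linT], intro allI impI)
    fix u assume "?T u = 0"
    let ?w = "?D u" and ?z = "X x"
    have f: "fst ?w = (snd ?w / (1 + snd ?z)) *\<^sub>R fst ?z"
      using \<open>?T u = 0\<close> by (simp add: boost_def)
    have z: "snd ?z > 0" "fst ?z \<bullet> fst ?z = snd ?z * snd ?z - 1"
      using hyperbolic[OF x] by (auto simp: hyperbolic_space_def lorentz_def)
    have "(snd ?w / (1 + snd ?z)) * (fst ?z \<bullet> fst ?z) = snd ?w * snd ?z"
      using lorentz_deriv_pos[OF x, of u] by (simp add: lorentz_def f)
    then have "snd ?w / (1 + snd ?z) * (fst ?z \<bullet> fst ?z) * (1 + snd ?z) = snd ?w * snd ?z * (1 + snd ?z)"
      by (simp only:)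
    moreover have "snd ?w / (1 + snd ?z) * (1 + snd ?z) = snd ?w" using z(1) by simp
    ultimately have "snd ?w * (snd ?z * snd ?z - 1) = snd ?w * snd ?z * (1 + snd ?z)"
      unfolding z(2) by algebra
    then have "snd ?w * (1 + snd ?z) = 0" by algebra
    then have "snd ?w = 0" using z by simp
    then have "?w = 0" using f by (simp add: prod_eq_iff)
    then show "u = 0" using injective[OF x] linear_injective_0[OF linD] by blast
  qed
  \<comment> \<open>The dimension count is what permits indexing the orthonormal basis by
    \<open>'n\<close> itself.\<close>
  have "dim (range ?T) = CARD('n)"
    using dim_image_eq[OF linT, of UNIV] \<open>inj ?T\<close> by (simp add: dim_UNIV)
  moreover obtain B where B: "B \<subseteq> range ?T" "pairwise orthogonal B"
      "\<And>b. b \<in> B \<Longrightarrow> norm b = 1" "independent B" "card B = dim (range ?T)"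
    using orthonormal_basis_subspace[OF linear_subspace_image[OF linT subspace_UNIV]] by metis
  ultimately obtain \<beta> :: "'n \<Rightarrow> _" where \<beta>: "bij_betw \<beta> UNIV B"
    using finite_same_card_bij[of "UNIV :: 'n set" B] independent_imp_finite[OF B(4)] by auto
  have "\<exists>u. ?T u = \<beta> a" for a
  proof -
    have "\<beta> a \<in> range ?T" using B(1) \<beta> by (auto simp: bij_betw_def)
    then show ?thesis by (auto simp: image_iff)
  qed
  then obtain E where "\<forall>a. ?T (E a) = \<beta> a" using choice[of "\<lambda>a u. ?T u = \<beta> a"] by blast
  then have E: "?T (E a) = \<beta> a" for a by simp
  have "orthonormal_frame X x E"
    unfolding orthonormal_frame_def
  proof (intro allI)
    fix a b
    have "\<beta> a \<bullet> \<beta> b = (if a = b then 1 else 0)"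
    proof (cases "a = b")
      case True
      then show ?thesis using B(3)[of "\<beta> b"] \<beta> by (auto simp: bij_betw_def norm_eq_1)
    next
      case False
      then have "\<beta> a \<noteq> \<beta> b" "\<beta> a \<in> B" "\<beta> b \<in> B" using \<beta> by (auto simp: bij_betw_def inj_eq)
      then show ?thesis using B(2) False by (auto simp: pairwise_def orthogonal_def)
    qed
    then show "lorentz (?D (E a)) (?D (E b)) = (if a = b then 1 else 0)"
      by (simp add: inner[symmetric] E)
  qed
  then show ?thesis by blast
qed

lemma metric_inverse:
  assumes "x \<in> U"
  shows "induced_metric X x ** inv_metric X x = mat 1" "invertible (induced_metric X x)"
    "0 < det (induced_metric X x)"
proof -
  obtain E where E: "orthonormal_frame X x E" using orthonormal_frame_exists[OF assms] ..
  note F = orthonormal_frame_metric[OF differentiable[OF assms] E]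
  show 1: "induced_metric X x ** inv_metric X x = mat 1" by (rule F(2))
  then show "invertible (induced_metric X x)"
    unfolding invertible_def by (metis matrix_left_right_inverse)
  show "0 < det (induced_metric X x)"
    using F(3) by (metis not_square_less_zero power2_eq_square zero_less_mult_iff zero_less_one)
qed

text \<open>A coordinate vector is already tangent to hyperbolic space, and
  \<open>tangent_proj\<close> reproduces it because metric times inverse metric is the identity. In
  a change of chart this kills the terms that contain second derivatives of the transition
  map.\<close>

lemma normal_proj_tangent [simp]:
  assumes x: "x \<in> U"
  shows "normal_proj X x (partial_deriv X m x) = 0"
proof -
  have h: "hyp_proj (X x) (partial_deriv X m x) = partial_deriv X m x"
    using lorentz_deriv_pos[OF x, of "axis m 1"] by (simp add: hyp_proj_def partial_deriv_def)
  have g: "(\<Sum>k\<in>UNIV. induced_metric X x $ m $ k * inv_metric X x $ k $ l) = (if m = l then 1 else 0)" for l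
    using metric_inverse(1)[OF x] by (simp add: vec_eq_iff matrix_matrix_mult_def mat_def)
  have "tangent_proj X x (partial_deriv X m x) =
      (\<Sum>l\<in>UNIV. (\<Sum>k\<in>UNIV. induced_metric X x $ m $ k * inv_metric X x $ k $ l) *\<^sub>R partial_deriv X l x)"
    unfolding tangent_proj_def
    by (subst sum.swap) (simp add: scaleR_sum_left induced_metric_def mult_ac)
  also have "\<dots> = partial_deriv X m x"
    unfolding g by (simp add: if_distrib[of "\<lambda>c. c *\<^sub>R _"] cong: if_cong)
  finally show ?thesis by (simp add: normal_proj_def h)
qed

text \<open>The second fundamental form takes values tangent to hyperbolic space, where Lorentz
  squares are nonnegative.\<close>

lemma lorentz_normal_proj_pos:
  assumes "x \<in> U"
  shows "lorentz (normal_proj X x w) (X x) = 0"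
proof -
  have "lorentz (partial_deriv X l x) (X x) = 0" for l
    using lorentz_deriv_pos[OF assms] by (simp add: partial_deriv_def)
  then have "lorentz (tangent_proj X x v) (X x) = 0" for v
    by (simp add: tangent_proj_def lorentz.sum_left lorentz.scaleR_left)
  then show ?thesis
    by (simp add: normal_proj_def lorentz.diff_left lorentz_hyp_proj hyperbolic assms)
qed

text \<open>In an orthonormal frame every summand is the Lorentz square of a vector tangent to
  hyperbolic space.\<close>

lemma second_ff_sq_nonneg:
  assumes x: "x \<in> U"
  shows "0 \<le> second_ff_sq X x"
proof -
  obtain E where E: "orthonormal_frame X x E" using orthonormal_frame_exists[OF x] ..
  have "lorentz (second_ff_form X x u v) (X x) = 0" for u v
    by (simp add: second_ff_form_def second_ff_eq lorentz.sum_left lorentz.scaleR_left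
        lorentz_normal_proj_pos x)
  then show ?thesis
    unfolding second_ff_sq_frame[OF differentiable[OF x] E]
    by (intro sum_nonneg lorentz_tangent_nonneg[OF hyperbolic[OF x]])
qed

lemma continuous_on_partial: "continuous_on U (partial_deriv X i)"
  by (rule smooth_onD(1)[OF smooth_onD(3)[OF smooth]])

lemma continuous_on_partial2: "continuous_on U (partial_deriv (partial_deriv X j) i)"
  by (rule smooth_onD(1)[OF smooth_onD(3)[OF smooth_onD(3)[OF smooth]]])

lemma continuous_on_pos: "continuous_on U X"
  by (rule smooth_onD(1)[OF smooth])

lemma continuous_on_metric: "continuous_on U (\<lambda>x. induced_metric X x $ i $ j)"
  by (simp add: induced_metric_def) (intro lorentz.continuous_on continuous_on_partial)

lemma continuous_on_det: "continuous_on U (\<lambda>x. det (induced_metric X x))"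
  by (rule continuous_on_metric_det[OF smooth])

lemma continuous_on_inv_metric: "continuous_on U (\<lambda>x. inv_metric X x $ k $ l)"
proof -
  \<comment> \<open>The test \<open>q\<close> will be \<open>j = k\<close> in the matrix of Cramer's
    rule; it does not depend on the point \<open>x\<close>.\<close>
  have "continuous_on U (\<lambda>x. (if q then c else induced_metric X x $ i $ j))" for q c i j
    by (cases q) (simp_all add: continuous_on_metric)
  then have "continuous_on U (\<lambda>x. det (\<chi> i j. if j = k then axis l 1 $ i else induced_metric X x $ i $ j)
      / det (induced_metric X x))"
    by (intro continuous_on_divide continuous_on_det)
       (auto simp: det_def dest: metric_inverse(3) intro!: continuous_intros)
  then show ?thesis
    by (subst continuous_on_cong[OF refl matrix_inv_nth]) (auto simp: metric_inverse)
qed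

lemma continuous_on_second_ff: "continuous_on U (\<lambda>x. second_ff X i j x)"
  unfolding second_ff_def hyp_connection_def tangent_proj_def hyp_proj_def
  by (intro continuous_on_inv_metric continuous_on_partial continuous_on_partial2 continuous_on_pos
      continuous_on_sum continuous_on_scaleR continuous_on_mult continuous_on_add continuous_on_diff
      lorentz.continuous_on)

lemma continuous_on_second_ff_sq: "continuous_on U (\<lambda>x. second_ff_sq X x)"
  unfolding second_ff_sq_def
  by (intro continuous_on_inv_metric continuous_on_second_ff continuous_on_sum continuous_on_mult
      lorentz.continuous_on)

end

section \<open>Invariance under a transition map \<open>\<tau>\<close> between two charts\<close>

locale reparametrization = X: immersed_patch U X + Y: immersed_patch V Y
  for U :: "(real^'n::finite) set" and X and V :: "(real^'n) set" and Y +
  fixes S :: "(real^'n) set" and \<tau> :: "real^'n \<Rightarrow> real^'n"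
  assumes open_S: "open S" and S_sub: "S \<subseteq> U" and smooth_\<tau>: "smooth_on S \<tau>"
    and \<tau>_in: "x \<in> S \<Longrightarrow> \<tau> x \<in> V" and XY: "x \<in> S \<Longrightarrow> X x = Y (\<tau> x)"
begin

lemma \<tau>_has_derivative: "x \<in> S \<Longrightarrow> (\<tau> has_derivative frechet_derivative \<tau> (at x)) (at x)"
  using smooth_onD(2)[OF smooth_\<tau>] frechet_derivative_works by blast

lemma deriv_eq:
  assumes "x \<in> S"
  shows "frechet_derivative X (at x) u = frechet_derivative Y (at (\<tau> x)) (frechet_derivative \<tau> (at x) u)"
proof -
  have "(Y \<circ> \<tau> has_derivative frechet_derivative Y (at (\<tau> x)) \<circ> frechet_derivative \<tau> (at x)) (at x)"
    by (rule diff_chain_at[OF \<tau>_has_derivative[OF assms] Y.has_derivative[OF \<tau>_in[OF assms]]])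
  then have "(X has_derivative frechet_derivative Y (at (\<tau> x)) \<circ> frechet_derivative \<tau> (at x)) (at x)"
    by (rule has_derivative_transform_within_open[OF _ open_S assms]) (simp add: XY)
  from fun_cong[OF frechet_derivative_at[OF this], of u] show ?thesis by simp
qed

lemma partial_deriv_eq:
  assumes "x \<in> S"
  shows "partial_deriv X j x = (\<Sum>k\<in>UNIV. partial_deriv \<tau> j x $ k *\<^sub>R partial_deriv Y k (\<tau> x))"
  using deriv_eq[OF assms, of "axis j 1"]
  unfolding frechet_derivative_eq_sum[OF Y.differentiable[OF \<tau>_in[OF assms]]]
    partial_deriv_def[of X] partial_deriv_def[of \<tau>] .

text \<open>By the chain rule both frames have the same image vectors in Minkowski space. All
  invariance statements that use frames reduce to this.\<close>

lemma frame_image: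
  assumes "x \<in> S" "orthonormal_frame X x E"
  shows "orthonormal_frame Y (\<tau> x) (\<lambda>a. frechet_derivative \<tau> (at x) (E a))"
  using assms(2) unfolding orthonormal_frame_def deriv_eq[OF assms(1)] .

lemma normal_proj_reparam:
  assumes x: "x \<in> S"
  shows "normal_proj X x = normal_proj Y (\<tau> x)"
proof -
  have xU: "x \<in> U" using x S_sub by blast
  obtain E where E: "orthonormal_frame X x E" using X.orthonormal_frame_exists[OF xU] ..
  have "tangent_proj X x w = tangent_proj Y (\<tau> x) w" for w
    by (simp add: tangent_proj_frame[OF X.differentiable[OF xU] E]
        tangent_proj_frame[OF Y.differentiable[OF \<tau>_in[OF x]] frame_image[OF x E]] deriv_eq[OF x])
  then show ?thesis by (simp add: normal_proj_def XY x fun_eq_iff)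
qed

text \<open>The frame matrix of \<open>Y\<close> is the Jacobian times that of \<open>X\<close>.
  Each metric determinant is the inverse square of the determinant of its frame matrix, so comparing
  the two gives the transformation law.\<close>

lemma det_metric_reparam:
  assumes x: "x \<in> S"
  shows "det (induced_metric X x) =
    (det (matrix (frechet_derivative \<tau> (at x))))\<^sup>2 * det (induced_metric Y (\<tau> x))"
proof -
  let ?J = "matrix (frechet_derivative \<tau> (at x))"
  have xU: "x \<in> U" using x S_sub by blast
  obtain E where E: "orthonormal_frame X x E" using X.orthonormal_frame_exists[OF xU] ..
  let ?M = "\<chi> i a. E a $ i"
  have lin: "linear (frechet_derivative \<tau> (at x))"
    by (rule linear_frechet_derivative[OF smooth_onD(2)[OF smooth_\<tau> x]])
  have "frechet_derivative \<tau> (at x) v = ?J *v v" for v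
    using fun_cong[OF matrix_vector_mul(2)[OF lin], of v] by simp
  then have "(\<chi> i a. frechet_derivative \<tau> (at x) (E a) $ i) = ?J ** ?M"
    by (simp add: vec_eq_iff matrix_vector_mult_def matrix_matrix_mult_def)
  then have "det (induced_metric Y (\<tau> x)) * (det ?J * det ?M)\<^sup>2 = 1"
    using orthonormal_frame_metric(3)[OF Y.differentiable[OF \<tau>_in[OF x]] frame_image[OF x E]]
    by (simp add: det_mul)
  moreover have M: "det (induced_metric X x) * (det ?M)\<^sup>2 = 1"
    by (rule orthonormal_frame_metric(3)[OF X.differentiable[OF xU] E])
  ultimately have "(det (induced_metric X x) - (det ?J)\<^sup>2 * det (induced_metric Y (\<tau> x))) * (det ?M)\<^sup>2 = 0"
    by (simp add: algebra_simps power_mult_distrib)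
  then show ?thesis using M by auto
qed

text \<open>Differentiating the chain rule for \<open>X\<close> once more gives second derivatives
  of \<open>Y\<close> and, through second derivatives of \<open>\<tau>\<close>, a combination of
  first derivatives of \<open>Y\<close>. The latter is tangent, and the normal projection removes
  it.\<close>

lemma second_ff_reparam:
  assumes x: "x \<in> S"
  shows "second_ff X i j x = second_ff_form Y (\<tau> x) (partial_deriv \<tau> i x) (partial_deriv \<tau> j x)"
proof -
  let ?c = "\<lambda>k y. partial_deriv \<tau> j y $ k"
  let ?dc = "\<lambda>k. frechet_derivative (partial_deriv \<tau> j) (at x) (axis i 1) $ k"
  let ?d\<tau> = "partial_deriv \<tau> i x"
  have 1: "((\<lambda>y. \<Sum>k\<in>UNIV. ?c k y *\<^sub>R partial_deriv Y k (\<tau> y)) has_derivative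
     (\<lambda>u. \<Sum>k\<in>UNIV. ?c k x *\<^sub>R frechet_derivative (partial_deriv Y k) (at (\<tau> x)) (frechet_derivative \<tau> (at x) u)
       + frechet_derivative (partial_deriv \<tau> j) (at x) u $ k *\<^sub>R partial_deriv Y k (\<tau> x))) (at x)"
  proof (intro has_derivative_sum has_derivative_scaleR)
    fix k
    have "(partial_deriv \<tau> j has_derivative frechet_derivative (partial_deriv \<tau> j) (at x)) (at x)"
      using smooth_onD(2)[OF smooth_onD(3)[OF smooth_\<tau>] x] frechet_derivative_works by blast
    then show "(?c k has_derivative (\<lambda>u. frechet_derivative (partial_deriv \<tau> j) (at x) u $ k)) (at x)"
      by (rule bounded_linear.has_derivative[OF bounded_linear_vec_nth])
    have "(partial_deriv Y k has_derivative frechet_derivative (partial_deriv Y k) (at (\<tau> x))) (at (\<tau> x))"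
      using smooth_onD(2)[OF smooth_onD(3)[OF Y.smooth] \<tau>_in[OF x]] frechet_derivative_works by blast
    from diff_chain_at[OF \<tau>_has_derivative[OF x] this]
    show "((\<lambda>y. partial_deriv Y k (\<tau> y)) has_derivative
        (\<lambda>u. frechet_derivative (partial_deriv Y k) (at (\<tau> x)) (frechet_derivative \<tau> (at x) u))) (at x)"
      by (simp add: o_def)
  qed
  \<comment> \<open>The chain-rule formula for the first derivative holds throughout the open set
    \<open>S\<close>, so it may be differentiated at \<open>x\<close>.\<close>
  have "partial_deriv (partial_deriv X j) i x =
      partial_deriv (\<lambda>y. \<Sum>k\<in>UNIV. ?c k y *\<^sub>R partial_deriv Y k (\<tau> y)) i x"
    by (rule partial_deriv_cong_open[OF open_S x partial_deriv_eq]) (use 1 in \<open>auto simp: differentiable_def\<close>)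
  also have "\<dots> = (\<Sum>k\<in>UNIV. ?c k x *\<^sub>R frechet_derivative (partial_deriv Y k) (at (\<tau> x)) ?d\<tau>
      + ?dc k *\<^sub>R partial_deriv Y k (\<tau> x))"
    using partial_deriv_eqI[OF 1] by (simp add: partial_deriv_def)
  also have "\<dots> = (\<Sum>k\<in>UNIV. ?c k x *\<^sub>R (\<Sum>l\<in>UNIV. ?d\<tau> $ l *\<^sub>R partial_deriv (partial_deriv Y k) l (\<tau> x))
      + ?dc k *\<^sub>R partial_deriv Y k (\<tau> x))"
    by (simp add: frechet_derivative_eq_sum[OF smooth_onD(2)[OF smooth_onD(3)[OF Y.smooth] \<tau>_in[OF x]]])
  finally have "second_ff X i j x = normal_proj Y (\<tau> x) \<dots>"
    by (simp add: second_ff_eq normal_proj_reparam[OF x])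
  also have "\<dots> = (\<Sum>k\<in>UNIV. \<Sum>l\<in>UNIV. (?d\<tau> $ l * ?c k x) *\<^sub>R second_ff Y l k (\<tau> x))"
    by (simp add: linear_sum[OF linear_normal_proj] linear_add[OF linear_normal_proj]
        linear_scale[OF linear_normal_proj] Y.normal_proj_tangent[OF \<tau>_in[OF x]] second_ff_eq scaleR_sum_right mult_ac)
  also have "\<dots> = second_ff_form Y (\<tau> x) ?d\<tau> (partial_deriv \<tau> j x)"
    unfolding second_ff_form_def by (rule sum.swap)
  finally show ?thesis .
qed

lemma second_ff_form_reparam:
  assumes x: "x \<in> S"
  shows "second_ff_form X x u v =
    second_ff_form Y (\<tau> x) (frechet_derivative \<tau> (at x) u) (frechet_derivative \<tau> (at x) v)"
proof -
  note b = bilinear_second_ff_form[of Y "\<tau> x"]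
  have "second_ff_form Y (\<tau> x) (frechet_derivative \<tau> (at x) u) (frechet_derivative \<tau> (at x) v) =
     (\<Sum>(i, j)\<in>UNIV \<times> UNIV. second_ff_form Y (\<tau> x) (u $ i *\<^sub>R partial_deriv \<tau> i x) (v $ j *\<^sub>R partial_deriv \<tau> j x))"
    unfolding frechet_derivative_eq_sum[OF smooth_onD(2)[OF smooth_\<tau> x]]
    by (rule bilinear_sum[OF b])
  also have "\<dots> = second_ff_form X x u v"
    by (simp add: sum.cartesian_product[symmetric] UNIV_Times_UNIV[symmetric] bilinear_lmul[OF b] bilinear_rmul[OF b]
        second_ff_form_def[of X] second_ff_reparam[OF x] mult_ac del: UNIV_Times_UNIV)
  finally show ?thesis ..
qed

text \<open>In matching frames the two sums agree term by term.\<close>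

lemma second_ff_sq_reparam:
  assumes x: "x \<in> S"
  shows "second_ff_sq X x = second_ff_sq Y (\<tau> x)"
proof -
  have xU: "x \<in> U" using x S_sub by blast
  obtain E where E: "orthonormal_frame X x E" using X.orthonormal_frame_exists[OF xU] ..
  show ?thesis
    unfolding second_ff_sq_frame[OF X.differentiable[OF xU] E]
      second_ff_sq_frame[OF Y.differentiable[OF \<tau>_in[OF x]] frame_image[OF x E]]
      second_ff_form_reparam[OF x] ..
qed

end


section \<open>Charts and the Riemannian volume\<close>

lemma chart_facts:
  assumes "smooth_manifold M" "(U, \<phi>) \<in> charts M"
  shows "open U" "openin (topo M) (\<phi> ` U)" "continuous_map (top_of_set U) (topo M) \<phi>"
    and "inj_on \<phi> U" "\<phi> ` U \<subseteq> topspace (topo M)"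
    and "open W \<Longrightarrow> W \<subseteq> U \<Longrightarrow> openin (topo M) (\<phi> ` W)"
proof -
  have "open U \<and> openin (topo M) (\<phi> ` U) \<and> homeomorphic_map (top_of_set U) (subtopology (topo M) (\<phi> ` U)) \<phi>"
    using assms unfolding smooth_manifold_def by fast
  then have o: "open U" and op: "openin (topo M) (\<phi> ` U)"
    and hom: "homeomorphic_map (top_of_set U) (subtopology (topo M) (\<phi> ` U)) \<phi>"
    by auto
  show "open U" "openin (topo M) (\<phi> ` U)" by fact+
  show "continuous_map (top_of_set U) (topo M) \<phi>"
    using homeomorphic_imp_continuous_map[OF hom] continuous_map_in_subtopology by blast
  show "inj_on \<phi> U" using homeomorphic_imp_injective_map[OF hom] by simp
  show "\<phi> ` U \<subseteq> topspace (topo M)" using op by (rule openin_subset)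
  assume W: "open W" "W \<subseteq> U"
  then have "openin (subtopology (topo M) (\<phi> ` U)) (\<phi> ` W)"
    using homeomorphic_imp_open_map[OF hom] o by (auto simp: open_map_def openin_open_eq)
  then show "openin (topo M) (\<phi> ` W)" using op by (rule openin_trans_full)
qed

lemma chart_cover:
  assumes "smooth_manifold M" "p \<in> topspace (topo M)"
  obtains U \<phi> x where "(U, \<phi>) \<in> charts M" "x \<in> U" "\<phi> x = p"
  using assms by (auto simp: smooth_manifold_def)

lemma chart_preimage_open:
  assumes "smooth_manifold M" "(U, \<phi>) \<in> charts M" "openin (topo M) W"
  shows "open {x \<in> U. \<phi> x \<in> W}"
proof -
  have "openin (top_of_set U) {x \<in> topspace (top_of_set U). \<phi> x \<in> W}"
    using openin_continuous_map_preimage[OF chart_facts(3)[OF assms(1,2)] assms(3)] .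
  then show ?thesis using chart_facts(1)[OF assms(1,2)] by (simp add: openin_open_eq)
qed

lemma chart_preimage_borel:
  assumes "smooth_manifold M" "(U, \<phi>) \<in> charts M" "B \<in> sets (borel_on (topo M))"
  shows "{x \<in> U. \<phi> x \<in> B} \<in> sets borel"
proof -
  have U: "U \<in> sets borel" using chart_facts(1)[OF assms(1,2)] by simp
  have "\<phi> \<in> measurable (restrict_space borel U) (borel_on (topo M))"
    unfolding borel_on_def
  proof (rule measurable_measure_of)
    show "{S. openin (topo M) S} \<subseteq> Pow (topspace (topo M))" by (auto dest: openin_subset)
    show "\<phi> \<in> space (restrict_space borel U) \<rightarrow> topspace (topo M)"
      using chart_facts(5)[OF assms(1,2)] by (auto simp: space_restrict_space)
    fix S assume "S \<in> {S. openin (topo M) S}"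
    then have "open {x\<in>U. \<phi> x \<in> S}" using chart_preimage_open[OF assms(1,2)] by blast
    then have "{x\<in>U. \<phi> x \<in> S} \<in> sets borel" by simp
    then show "\<phi> -` S \<inter> space (restrict_space borel U) \<in> sets (restrict_space borel U)"
      using U by (auto simp: space_restrict_space sets_restrict_space_iff vimage_def Int_def conj_commute)
  qed
  from measurable_sets[OF this assms(3)] have "\<phi> -` B \<inter> U \<in> sets borel"
    using U by (simp add: space_restrict_space sets_restrict_space_iff)
  then show ?thesis by (simp add: vimage_def Int_def conj_commute)
qed

lemma chart_immersed_patch:
  assumes M: "immersed_hypersurface M" and c: "(U, \<phi>) \<in> charts M"
  shows "immersed_patch U (pos M \<circ> \<phi>)"
proof -
  have sm: "smooth_manifold M" using M by (simp add: immersed_hypersurface_def)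
  have "smooth_on U (pos M \<circ> \<phi>) \<and> (\<forall>x\<in>U. inj (frechet_derivative (pos M \<circ> \<phi>) (at x)))"
    using M c unfolding immersed_hypersurface_def by fast
  moreover have "pos M (\<phi> x) \<in> hyperbolic_space" if "x \<in> U" for x
    using M chart_facts(5)[OF sm c] that unfolding immersed_hypersurface_def by blast
  ultimately show ?thesis
    using chart_facts(1)[OF sm c] by (simp add: immersed_patch_def)
qed

lemma transition_reparametrization:
  assumes M: "immersed_hypersurface M" and c: "(U, \<phi>) \<in> charts M" and d: "(V, \<psi>) \<in> charts M"
  shows "reparametrization U (pos M \<circ> \<phi>) V (pos M \<circ> \<psi>) {x \<in> U. \<phi> x \<in> \<psi> ` V} (inv_into V \<psi> \<circ> \<phi>)"
proof -
  have sm: "smooth_manifold M" using M by (simp add: immersed_hypersurface_def)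
  interpret X: immersed_patch U "pos M \<circ> \<phi>" by (rule chart_immersed_patch[OF M c])
  interpret Y: immersed_patch V "pos M \<circ> \<psi>" by (rule chart_immersed_patch[OF M d])
  show ?thesis
  proof
    show "open {x \<in> U. \<phi> x \<in> \<psi> ` V}"
      by (rule chart_preimage_open[OF sm c chart_facts(2)[OF sm d]])
    show "smooth_on {x \<in> U. \<phi> x \<in> \<psi> ` V} (inv_into V \<psi> \<circ> \<phi>)"
      using sm c d unfolding smooth_manifold_def by fast
  qed (auto simp: inv_into_f_f chart_facts(4)[OF sm d])
qed

text \<open>The arbitrary choice inside \<open>chart_at\<close> is harmless: the chosen chart and
  the given one overlap at the point, and the transition map preserves
  \<open>second_ff_sq\<close>.\<close>

lemma normA_chart:
  assumes M: "immersed_hypersurface M" and c: "(U, \<phi>) \<in> charts M" and x: "x \<in> U"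
  shows "normA M (\<phi> x) = sqrt (second_ff_sq (pos M \<circ> \<phi>) x)"
proof -
  have sm: "smooth_manifold M" using M by (simp add: immersed_hypersurface_def)
  let ?P = "\<lambda>(\<psi>, y). \<exists>V. (V, \<psi>) \<in> charts M \<and> y \<in> V \<and> \<psi> y = \<phi> x"
  have "?P (chart_at M (\<phi> x))"
    unfolding chart_at_def by (rule someI[of ?P "(\<phi>, x)"]) (use c x in auto)
  then obtain V \<psi> y where ca: "chart_at M (\<phi> x) = (\<psi>, y)" and d: "(V, \<psi>) \<in> charts M"
    and y: "y \<in> V" "\<psi> y = \<phi> x"
    by (cases "chart_at M (\<phi> x)") auto
  interpret reparametrization U "pos M \<circ> \<phi>" V "pos M \<circ> \<psi>" "{x \<in> U. \<phi> x \<in> \<psi> ` V}" "inv_into V \<psi> \<circ> \<phi>"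
    by (rule transition_reparametrization[OF M c d])
  have "inv_into V \<psi> (\<phi> x) = y"
    using inv_into_f_f[OF chart_facts(4)[OF sm d] y(1)] y(2) by simp
  moreover have "\<phi> x \<in> \<psi> ` V" using y by force
  ultimately have "second_ff_sq (pos M \<circ> \<phi>) x = second_ff_sq (pos M \<circ> \<psi>) y"
    using second_ff_sq_reparam[of x] x by simp
  then show ?thesis by (simp add: normA_def ca)
qed

text \<open>Charts are open maps, so the preimage of an open set is a union of open pieces, one from
  each chart.\<close>

lemma continuous_map_chartwise:
  fixes f :: "'a \<Rightarrow> real"
  assumes M: "smooth_manifold M"
    and f: "\<And>U \<phi>. (U, \<phi>) \<in> charts M \<Longrightarrow> continuous_on U (\<lambda>x. f (\<phi> x))"
  shows "continuous_map (topo M) euclideanreal f"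
  unfolding continuous_map
proof (intro conjI allI impI)
  fix W :: "real set" assume W: "openin euclidean W"
  have "openin (topo M) {p \<in> \<phi> ` U. f p \<in> W}" if c: "(U, \<phi>) \<in> charts M" for U \<phi>
  proof -
    have "open {x \<in> U. f (\<phi> x) \<in> W}"
      using continuous_openin_preimage_gen[OF f[OF c]] W chart_facts(1)[OF M c]
      by (simp add: openin_open_eq vimage_def Int_def)
    then have "openin (topo M) (\<phi> ` {x \<in> U. f (\<phi> x) \<in> W})"
      by (rule chart_facts(6)[OF M c]) auto
    also have "\<phi> ` {x \<in> U. f (\<phi> x) \<in> W} = {p \<in> \<phi> ` U. f p \<in> W}" by auto
    finally show ?thesis .
  qed
  then have "openin (topo M) (\<Union>(U, \<phi>)\<in>charts M. {p \<in> \<phi> ` U. f p \<in> W})"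
    by (intro openin_Union) auto
  also have "(\<Union>(U, \<phi>)\<in>charts M. {p \<in> \<phi> ` U. f p \<in> W}) = {p \<in> topspace (topo M). f p \<in> W}"
    using M by (auto simp: smooth_manifold_def)
  finally show "openin (topo M) {p \<in> topspace (topo M). f p \<in> W}" .
qed simp

lemma continuous_map_borel_on:
  fixes f :: "'a \<Rightarrow> real"
  assumes "continuous_map T euclideanreal f"
  shows "f \<in> borel_measurable (borel_on T)"
proof (rule borel_measurableI)
  fix S :: "real set" assume "open S"
  then have "openin T {p \<in> topspace T. f p \<in> S}"
    using openin_continuous_map_preimage[OF assms] by simp
  then show "f -` S \<inter> space (borel_on T) \<in> sets (borel_on T)"
    using borel_on_open by (simp add: vimage_def Int_def conj_commute)
qed

lemma continuous_map_normA:
  assumes M: "immersed_hypersurface M"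
  shows "continuous_map (topo M) euclideanreal (normA M)"
proof (rule continuous_map_chartwise)
  show "smooth_manifold M" using M by (simp add: immersed_hypersurface_def)
  fix U \<phi> assume c: "(U, \<phi>) \<in> charts M"
  interpret immersed_patch U "pos M \<circ> \<phi>" by (rule chart_immersed_patch[OF M c])
  have "continuous_on U (\<lambda>x. sqrt (second_ff_sq (pos M \<circ> \<phi>) x))"
    by (intro continuous_on_real_sqrt continuous_on_second_ff_sq)
  then show "continuous_on U (\<lambda>x. normA M (\<phi> x))"
    by (rule continuous_on_cong[THEN iffD1, OF refl, rotated]) (simp add: normA_chart[OF M c])
qed

lemma normA_nonneg:
  assumes M: "immersed_hypersurface M" and p: "p \<in> topspace (topo M)"
  shows "0 \<le> normA M p"
proof -
  have "smooth_manifold M" using M by (simp add: immersed_hypersurface_def)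
  then obtain U \<phi> x where c: "(U, \<phi>) \<in> charts M" "x \<in> U" "\<phi> x = p"
    by (rule chart_cover[OF _ p])
  interpret immersed_patch U "pos M \<circ> \<phi>" by (rule chart_immersed_patch[OF M c(1)])
  show ?thesis
    using normA_chart[OF M c(1,2)] second_ff_sq_nonneg[OF c(2)] c(3) by simp
qed

text \<open>Change of variables along the transition map: the root of the metric determinant picks
  up exactly the absolute Jacobian, by \<open>det_metric_reparam\<close>.\<close>

lemma chart_volume_agree:
  assumes M: "immersed_hypersurface M" and c: "(U, \<phi>) \<in> charts M" and d: "(V, \<psi>) \<in> charts M"
    and B: "B \<in> sets (borel_on (topo M))" "B \<subseteq> \<phi> ` U \<inter> \<psi> ` V"
  shows "emeasure (chart_volume M (U, \<phi>)) B = emeasure (chart_volume M (V, \<psi>)) B"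
proof -
  have sm: "smooth_manifold M" using M by (simp add: immersed_hypersurface_def)
  define \<tau> where "\<tau> = inv_into V \<psi> \<circ> \<phi>"
  define X where "X = pos M \<circ> \<phi>"
  define Y where "Y = pos M \<circ> \<psi>"
  interpret reparametrization U X V Y "{x \<in> U. \<phi> x \<in> \<psi> ` V}" \<tau>
    unfolding X_def Y_def \<tau>_def by (rule transition_reparametrization[OF M c d])
  define A where "A = {x \<in> U. \<phi> x \<in> B}"
  define A' where "A' = {y \<in> V. \<psi> y \<in> B}"
  have A: "A \<in> sets borel" and A': "A' \<in> sets borel"
    unfolding A_def A'_def by (rule chart_preimage_borel[OF sm _ B(1)], fact)+
  have AS: "x \<in> {x \<in> U. \<phi> x \<in> \<psi> ` V}" if "x \<in> A" for x using that B(2) by (auto simp: A_def)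
  have \<psi>\<tau>: "\<psi> (\<tau> x) = \<phi> x" if "x \<in> A" for x
    using AS[OF that] by (auto simp: \<tau>_def f_inv_into_f)
  have im: "\<tau> ` A = A'"
  proof
    show "\<tau> ` A \<subseteq> A'"
      using \<tau>_in[OF AS] \<psi>\<tau> by (auto simp: A'_def A_def)
    show "A' \<subseteq> \<tau> ` A"
    proof
      fix y assume y: "y \<in> A'"
      then obtain x where x: "x \<in> U" "\<phi> x = \<psi> y" using B(2) by (auto simp: A'_def)
      then have "\<tau> x = y" "x \<in> A"
        using y chart_facts(4)[OF sm d] by (auto simp: \<tau>_def A_def A'_def inv_into_f_f)
      then show "y \<in> \<tau> ` A" by blast
    qed
  qed
  have inj: "inj_on \<tau> A"
  proof (rule inj_onI)
    fix x y assume "x \<in> A" "y \<in> A" "\<tau> x = \<tau> y"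
    then have "\<phi> x = \<phi> y" using \<psi>\<tau> by metis
    then show "x = y" using \<open>x \<in> A\<close> \<open>y \<in> A\<close> chart_facts(4)[OF sm c] by (auto simp: A_def dest: inj_onD)
  qed
  let ?h = "\<lambda>y. sqrt (det (induced_metric Y y))"
  let ?J = "\<lambda>x. \<bar>det (matrix (frechet_derivative \<tau> (at x)))\<bar>"
  have J: "sqrt (det (induced_metric X x)) = ?J x * ?h (\<tau> x)" if "x \<in> A" for x
    by (simp add: det_metric_reparam[OF AS[OF that]] real_sqrt_mult)
  have cov: "(\<integral>\<^sup>+y. ennreal (indicator (\<tau> ` A) y * ?h y) \<partial>lborel) =
      (\<integral>\<^sup>+x. ennreal (indicator A x * (?J x * ?h (\<tau> x))) \<partial>lborel)"
  proof (rule nn_integral_change_of_variables[OF A _ inj])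
    show "(\<tau> has_derivative frechet_derivative \<tau> (at x)) (at x within A)" if "x \<in> A" for x
      using \<tau>_has_derivative[OF AS[OF that]] by (rule has_derivative_at_withinI)
    show "0 \<le> ?h y" if "y \<in> \<tau> ` A" for y
      using that Y.metric_inverse(3)[of y] by (auto simp: im A'_def intro: less_imp_le)
    have "continuous_on A' ?h"
      by (rule continuous_on_subset[OF continuous_on_real_sqrt[OF Y.continuous_on_det]]) (auto simp: A'_def)
    from borel_measurable_continuous_on_indicator[OF A' this]
    show "(\<lambda>y. indicator (\<tau> ` A) y * ?h y) \<in> borel_measurable borel" by (simp add: im)
    \<comment> \<open>Measurability of the transformed integrand comes from the other side: on
      \<open>A\<close> it equals the volume density of \<open>X\<close>, so the Jacobian need not be
      examined by itself.\<close>
    have "continuous_on A (\<lambda>x. sqrt (det (induced_metric X x)))"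
      by (rule continuous_on_subset[OF continuous_on_real_sqrt[OF X.continuous_on_det]]) (auto simp: A_def)
    from borel_measurable_continuous_on_indicator[OF A this]
    have "(\<lambda>x. indicator A x * sqrt (det (induced_metric X x))) \<in> borel_measurable borel" by simp
    also have "(\<lambda>x. indicator A x * sqrt (det (induced_metric X x))) = (\<lambda>x. indicator A x * (?J x * ?h (\<tau> x)))"
      using J by (auto simp: indicator_def fun_eq_iff)
    finally show "(\<lambda>x. indicator A x * (?J x * ?h (\<tau> x))) \<in> borel_measurable borel" .
  qed
  have "emeasure (chart_volume M (U, \<phi>)) B = (\<integral>\<^sup>+x. ennreal (indicator A x * (?J x * ?h (\<tau> x))) \<partial>lborel)"
    unfolding emeasure_chart_volume[OF M c B(1)] X_def[symmetric] A_def[symmetric]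
    using J by (intro nn_integral_cong) (auto simp: indicator_def)
  moreover have "emeasure (chart_volume M (V, \<psi>)) B = (\<integral>\<^sup>+y. ennreal (indicator (\<tau> ` A) y * ?h y) \<partial>lborel)"
    unfolding emeasure_chart_volume[OF M d B(1)] Y_def[symmetric] A'_def[symmetric] im
    by (intro nn_integral_cong) (auto simp: indicator_def)
  ultimately show ?thesis using cov by simp
qed

text \<open>A second countable space is Lindelof, so countably many chart images suffice.\<close>

lemma countable_chart_cover:
  assumes M: "smooth_manifold M" "charts M \<noteq> {}"
  shows "\<exists>c :: nat \<Rightarrow> _. (\<forall>i. c i \<in> charts M) \<and> topspace (topo M) \<subseteq> (\<Union>i. snd (c i) ` fst (c i))"
proof -
  let ?im = "\<lambda>c. snd c ` fst c"
  have "Lindelof_space (topo M)"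
    using M second_countable_imp_Lindelof_space by (auto simp: smooth_manifold_def)
  moreover have "\<forall>W\<in>?im ` charts M. openin (topo M) W"
    using chart_facts(2)[OF M(1)] by auto
  moreover have "\<Union>(?im ` charts M) = topspace (topo M)"
    using M(1) by (auto simp: smooth_manifold_def case_prod_beta)
  ultimately obtain W where W: "countable W" "W \<subseteq> ?im ` charts M" "\<Union>W = topspace (topo M)"
    unfolding Lindelof_space_def by meson
  then obtain C where C: "countable C" "C \<subseteq> charts M" "W = ?im ` C"
    using countable_subset_image[of W ?im "charts M"] by blast
  obtain d where d: "d \<in> charts M" using M(2) by blast
  \<comment> \<open>Inserting \<open>d\<close> keeps the enumerated set nonempty even if the
    subcover is empty, as may happen when the manifold has no points.\<close>
  define c where "c = from_nat_into (insert d C)"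
  have "range c = insert d C"
    unfolding c_def by (rule range_from_nat_into) (use C in auto)
  note rc = this
  show ?thesis
  proof (intro exI[of _ c] conjI allI)
    show "c i \<in> charts M" for i
      using rc rangeI[of c i] C(2) d by auto
    show "topspace (topo M) \<subseteq> (\<Union>i. snd (c i) ` fst (c i))"
    proof
      fix p assume "p \<in> topspace (topo M)"
      then obtain e where "e \<in> C" "p \<in> ?im e" using W(3) C(3) by blast
      moreover from \<open>e \<in> C\<close> obtain i where "e = c i" using rc by blast
      ultimately show "p \<in> (\<Union>i. snd (c i) ` fst (c i))" by blast
    qed
  qed
qed

text \<open>The supremum is identified by exhibiting a measure \<open>N\<close> to which
  \<open>riem_volume_eqI\<close> applies. Disjoint Borel pieces \<open>D i\<close>, each inside a
  chart of a countable cover, are measured by their own chart volumes, and the contributions are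
  added.\<close>

lemma riem_volume_chart:
  assumes M: "immersed_hypersurface M"
  shows sets_riem_volume: "sets (riem_volume M) = sets (borel_on (topo M))"
    and emeasure_riem_volume_chart: "\<And>U \<phi> B. (U, \<phi>) \<in> charts M \<Longrightarrow> B \<in> sets (borel_on (topo M)) \<Longrightarrow>
      emeasure (riem_volume M) (B \<inter> \<phi> ` U) = emeasure (chart_volume M (U, \<phi>)) B"
proof -
  have sm: "smooth_manifold M" using M by (simp add: immersed_hypersurface_def)
  have "\<exists>N. sets N = sets (borel_on (topo M)) \<and>
    (\<forall>U \<phi> B. (U, \<phi>) \<in> charts M \<longrightarrow> B \<in> sets N \<longrightarrow>
      emeasure (chart_volume M (U, \<phi>)) B = emeasure N (B \<inter> \<phi> ` U))"
  proof (cases "charts M = {}")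
    case True
    then show ?thesis by auto
  next
    case False
    from countable_chart_cover[OF sm False]
    obtain c :: "nat \<Rightarrow> _" where
      cc: "(\<forall>i. c i \<in> charts M) \<and> topspace (topo M) \<subseteq> (\<Union>i. snd (c i) ` fst (c i))" ..
    have c: "c i \<in> charts M" for i using cc by simp
    have cov: "topspace (topo M) \<subseteq> (\<Union>i. snd (c i) ` fst (c i))" using cc by simp
    define P where "P i = snd (c i) ` fst (c i)" for i
    let ?S = "sets (borel_on (topo M))"
    define D where "D = disjointed P"
    have "P i \<in> ?S" for i
      using borel_on_open[OF chart_facts(2)[OF sm, of "fst (c i)" "snd (c i)"]] c by (simp add: P_def)
    then have D: "D i \<in> ?S" for i
      using sets.range_disjointed_sets[of P "borel_on (topo M)"] by (auto simp: D_def)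
    have disj: "disjoint_family D" by (simp add: D_def disjoint_family_disjointed)
    have DP: "D i \<subseteq> P i" for i by (simp add: D_def disjointed_subset)
    have UD: "topspace (topo M) \<subseteq> (\<Union>i. D i)"
      using cov by (simp add: D_def UN_disjointed_eq P_def)
    \<comment> \<open>Writing the sum over the pieces as an integral over counting measure reduces
      countable additivity to exchanging a sum with an integral.\<close>
    define \<mu> where "\<mu> B = (\<integral>\<^sup>+i. emeasure (chart_volume M (c i)) (B \<inter> D i) \<partial>count_space UNIV)" for B
    define N where "N = measure_of (topspace (topo M)) ?S \<mu>"
    have sigma: "sigma_algebra (topspace (topo M)) ?S"
      using sets.sigma_algebra_axioms[of "borel_on (topo M)"] by simp
    have sN: "sets N = ?S"
      unfolding N_def using sigma_algebra.sets_measure_of_eq[OF sigma] by simp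
    have "countably_additive ?S \<mu>"
    proof (rule countably_additiveI)
      fix A :: "nat \<Rightarrow> _" assume A: "range A \<subseteq> ?S" "disjoint_family A"
      have "(\<Sum>k. \<mu> (A k)) = (\<integral>\<^sup>+i. (\<Sum>k. emeasure (chart_volume M (c i)) (A k \<inter> D i)) \<partial>count_space UNIV)"
        unfolding \<mu>_def by (rule nn_integral_suminf[symmetric]) simp
      also have "\<dots> = \<mu> (\<Union>k. A k)"
        unfolding \<mu>_def
      proof (rule nn_integral_cong)
        fix i
        have "(\<Sum>k. emeasure (chart_volume M (c i)) (A k \<inter> D i)) = emeasure (chart_volume M (c i)) (\<Union>k. A k \<inter> D i)"
          by (rule suminf_emeasure) (use A D in \<open>auto simp: disjoint_family_on_def\<close>)
        also have "(\<Union>k. A k \<inter> D i) = (\<Union>k. A k) \<inter> D i" by blast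
        finally show "(\<Sum>k. emeasure (chart_volume M (c i)) (A k \<inter> D i)) =
          emeasure (chart_volume M (c i)) ((\<Union>k. A k) \<inter> D i)" .
      qed
      finally show "(\<Sum>k. \<mu> (A k)) = \<mu> (\<Union>k. A k)" .
    qed
    moreover have "positive ?S \<mu>" by (simp add: positive_def \<mu>_def)
    ultimately have eN: "emeasure N B = \<mu> B" if "B \<in> ?S" for B
      unfolding N_def using that by (intro emeasure_measure_of_sigma[OF sigma])
    have "emeasure (chart_volume M (U, \<phi>)) B = emeasure N (B \<inter> \<phi> ` U)"
      if e: "(U, \<phi>) \<in> charts M" and B: "B \<in> ?S" for U \<phi> B
    proof -
      let ?B = "B \<inter> \<phi> ` U"
      have B': "?B \<in> ?S" using B borel_on_open[OF chart_facts(2)[OF sm e]] by auto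
      have sub: "?B \<subseteq> (\<Union>i. D i)" using sets.sets_into_space[OF B'] UD by auto
      have "{x\<in>U. \<phi> x \<in> B} = {x\<in>U. \<phi> x \<in> ?B}" by auto
      then have "emeasure (chart_volume M (U, \<phi>)) B = emeasure (chart_volume M (U, \<phi>)) ?B"
        unfolding emeasure_chart_volume[OF M e B] emeasure_chart_volume[OF M e B'] by simp
      also have "?B = (\<Union>i. ?B \<inter> D i)" using sub by blast
      also have "emeasure (chart_volume M (U, \<phi>)) \<dots> = (\<Sum>i. emeasure (chart_volume M (U, \<phi>)) (?B \<inter> D i))"
        by (rule suminf_emeasure[symmetric])
           (use B' D disj in \<open>auto simp: disjoint_family_on_def\<close>)
      \<comment> \<open>Each set \<open>?B \<inter> D i\<close> lies in the images of both charts,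
        so their volumes agree on it.\<close>
      also have "\<dots> = (\<Sum>i. emeasure (chart_volume M (c i)) (?B \<inter> D i))"
      proof (intro suminf_cong)
        fix i
        have "emeasure (chart_volume M (U, \<phi>)) (?B \<inter> D i) =
            emeasure (chart_volume M (fst (c i), snd (c i))) (?B \<inter> D i)"
          by (rule chart_volume_agree[OF M e]) (use c D B' DP[of i] in \<open>auto simp: P_def\<close>)
        then show "emeasure (chart_volume M (U, \<phi>)) (?B \<inter> D i) = emeasure (chart_volume M (c i)) (?B \<inter> D i)"
          by simp
      qed
      also have "\<dots> = emeasure N ?B"
        unfolding eN[OF B'] \<mu>_def by (simp add: nn_integral_count_space_nat)
      finally show ?thesis .
    qed
    then show ?thesis using sN by auto
  qed
  then obtain N where sN: "sets N = sets (borel_on (topo M))" and N: "\<And>U \<phi> B. (U, \<phi>) \<in> charts M \<Longrightarrow>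
      B \<in> sets N \<Longrightarrow> emeasure (chart_volume M (U, \<phi>)) B = emeasure N (B \<inter> \<phi> ` U)" by metis
  have "riem_volume M = N" by (rule riem_volume_eqI[OF sm sN N])
  with sN N show "sets (riem_volume M) = sets (borel_on (topo M))"
    "\<And>U \<phi> B. (U, \<phi>) \<in> charts M \<Longrightarrow> B \<in> sets (borel_on (topo M)) \<Longrightarrow>
      emeasure (riem_volume M) (B \<inter> \<phi> ` U) = emeasure (chart_volume M (U, \<phi>)) B"
    by simp_all
qed

lemma space_riem_volume:
  "immersed_hypersurface M \<Longrightarrow> space (riem_volume M) = topspace (topo M)"
  using sets_eq_imp_space_eq[OF sets_riem_volume] by simp

text \<open>The continuous volume density is bounded on a closed ball inside the chart domain, and
  the image of the open ball is the required neighbourhood.\<close>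

lemma locally_finite_riem_volume:
  assumes M: "immersed_hypersurface M" and p: "p \<in> topspace (topo M)"
  shows "\<exists>W. openin (topo M) W \<and> p \<in> W \<and> emeasure (riem_volume M) W < \<infinity>"
proof -
  have sm: "smooth_manifold M" using M by (simp add: immersed_hypersurface_def)
  obtain U \<phi> x where c: "(U, \<phi>) \<in> charts M" "x \<in> U" "\<phi> x = p"
    using chart_cover[OF sm p] by blast
  interpret immersed_patch U "pos M \<circ> \<phi>" by (rule chart_immersed_patch[OF M c(1)])
  obtain r where r: "r > 0" "cball x r \<subseteq> U"
    using open_contains_cball open_dom c(2) by blast
  let ?h = "\<lambda>x. sqrt (det (induced_metric (pos M \<circ> \<phi>) x))"
  have "compact (?h ` cball x r)"
    by (rule compact_continuous_image[OF continuous_on_subset[OF continuous_on_real_sqrt[OF continuous_on_det] r(2)]])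
       simp
  then have "bounded (?h ` cball x r)" by (rule compact_imp_bounded)
  then obtain C where "\<forall>z\<in>?h ` cball x r. norm z \<le> C" unfolding bounded_iff by blast
  then have C: "\<bar>?h y\<bar> \<le> C" if "y \<in> cball x r" for y using that by auto
  let ?W = "\<phi> ` ball x r"
  have sub: "ball x r \<subseteq> U" using r(2) ball_subset_cball by blast
  have op: "openin (topo M) ?W" by (rule chart_facts(6)[OF sm c(1) open_ball sub])
  have pre: "{y \<in> U. \<phi> y \<in> ?W} = ball x r"
    using chart_facts(4)[OF sm c(1)] sub by (auto dest: inj_onD)
  have "?W \<inter> \<phi> ` U = ?W" using sub by blast
  then have "emeasure (riem_volume M) ?W = emeasure (chart_volume M (U, \<phi>)) ?W"
    using emeasure_riem_volume_chart[OF M c(1) borel_on_open[OF op]] by simp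
  also have "\<dots> = (\<integral>\<^sup>+y\<in>ball x r. ennreal (?h y) \<partial>lborel)"
    by (simp add: emeasure_chart_volume[OF M c(1) borel_on_open[OF op]] pre)
  also have "\<dots> \<le> (\<integral>\<^sup>+y. ennreal C * indicator (ball x r) y \<partial>lborel)"
  proof (rule nn_integral_mono)
    fix y
    show "ennreal (?h y) * indicator (ball x r) y \<le> ennreal C * indicator (ball x r) y"
      using C[of y] by (auto simp: indicator_def intro!: ennreal_leI)
  qed
  also have "\<dots> = ennreal C * emeasure lborel (ball x r)"
    by (rule nn_integral_cmult_indicator) simp
  also have "\<dots> < \<infinity>"
    using emeasure_lborel_ball_finite[of x r] by (simp add: ennreal_mult_less_top)
  finally have "emeasure (riem_volume M) ?W < \<infinity>" .
  moreover have "p \<in> ?W" using c(3) r(1) by force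
  ultimately show ?thesis using op by blast
qed

text \<open>Compact sets are closed in a Hausdorff space, hence Borel, and finitely many open sets
  of finite volume cover them.\<close>

lemma compact_finite_riem_volume:
  assumes M: "immersed_hypersurface M" and K: "compactin (topo M) K"
  shows "K \<in> sets (riem_volume M)" "emeasure (riem_volume M) K < \<infinity>"
proof -
  have "Hausdorff_space (topo M)"
    using M by (simp add: immersed_hypersurface_def smooth_manifold_def)
  then have "closedin (topo M) K" using K compactin_imp_closedin by blast
  then have cl: "K \<subseteq> topspace (topo M)" "openin (topo M) (topspace (topo M) - K)"
    by (auto simp: closedin_def)
  then have "topspace (topo M) - (topspace (topo M) - K) \<in> sets (borel_on (topo M))"
    using borel_on_open sets.compl_sets[of _ "borel_on (topo M)"] by fastforce
  moreover have "topspace (topo M) - (topspace (topo M) - K) = K" using cl by blast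
  ultimately show KS: "K \<in> sets (riem_volume M)" using sets_riem_volume[OF M] by simp
  let ?\<W> = "{W. openin (topo M) W \<and> emeasure (riem_volume M) W < \<infinity>}"
  have "K \<subseteq> \<Union>?\<W>" using locally_finite_riem_volume[OF M] cl(1) by blast
  then obtain F where F: "finite F" "F \<subseteq> ?\<W>" "K \<subseteq> \<Union>F"
    using K unfolding compactin_def by (metis (no_types, lifting) mem_Collect_eq)
  have FS: "W \<in> sets (riem_volume M)" if "W \<in> F" for W
    using that F(2) borel_on_open sets_riem_volume[OF M] by auto
  have "emeasure (riem_volume M) K \<le> emeasure (riem_volume M) (\<Union>W\<in>F. W)"
    by (rule emeasure_mono) (use F FS in auto)
  also have "\<dots> \<le> (\<Sum>W\<in>F. emeasure (riem_volume M) W)"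
    by (rule emeasure_subadditive_finite) (use F FS in auto)
  also have "\<dots> < \<infinity>" using F(1,2) by (induction F rule: finite_induct) auto
  finally show "emeasure (riem_volume M) K < \<infinity>" .
qed


section \<open>Stability\<close>

lemma norm_frechet_derivative_le:
  fixes f :: "real^'n::finite \<Rightarrow> 'b::real_normed_vector"
  assumes "f differentiable (at x)" "\<And>i. norm (partial_deriv f i x) \<le> B"
  shows "norm (frechet_derivative f (at x) u) \<le> real CARD('n) * B * norm u"
proof -
  have "norm (frechet_derivative f (at x) u) \<le> (\<Sum>i\<in>UNIV. norm (u $ i *\<^sub>R partial_deriv f i x))"
    unfolding frechet_derivative_eq_sum[OF assms(1)] by (rule norm_sum)
  also have "\<dots> \<le> (\<Sum>i\<in>(UNIV :: 'n set). norm u * B)"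
    by (intro sum_mono) (simp add: mult_mono assms(2) component_le_norm_cart)
  finally show ?thesis by (simp add: mult_ac)
qed

text \<open>The image of a straight segment in a chart is a competitor for the distance.\<close>

lemma riem_dist_chart_le:
  assumes M: "immersed_hypersurface M" and c: "(U, \<phi>) \<in> charts M"
    and seg: "closed_segment x y \<subseteq> U" and B: "0 \<le> B"
    and bound: "\<And>z. z \<in> closed_segment x y \<Longrightarrow> norm (frechet_derivative (pos M \<circ> \<phi>) (at z) (y - x)) \<le> B"
  shows "riem_dist M (\<phi> x) (\<phi> y) \<le> ennreal B"
proof -
  have sm: "smooth_manifold M" using M by (simp add: immersed_hypersurface_def)
  define X where "X = pos M \<circ> \<phi>"
  interpret immersed_patch U X unfolding X_def by (rule chart_immersed_patch[OF M c])
  define l where "l t = x + t *\<^sub>R (y - x)" for t :: real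
  define D where "D t = frechet_derivative X (at (l t)) (y - x)" for t
  have l: "l t \<in> closed_segment x y" if "t \<in> {0..1}" for t
    using that by (auto simp: l_def closed_segment_def algebra_simps intro!: exI[of _ t])
  have lU: "l t \<in> U" if "t \<in> {0..1}" for t using l[OF that] seg by blast
  have cl: "continuous_on T l" for T unfolding l_def by (intro continuous_intros)
  \<comment> \<open>The derivative is two-sided even at the endpoints of the interval:
    \<open>l\<close> is an affine line on all of the reals, and \<open>X\<close> is differentiable
    at every point of the open set \<open>U\<close>.\<close>
  have vd: "((pos M \<circ> (\<phi> \<circ> l)) has_vector_derivative D t) (at t)" if "t \<in> {0..1}" for t
  proof -
    have "(l has_derivative (\<lambda>h. h *\<^sub>R (y - x))) (at t)"
      unfolding l_def by (auto intro!: derivative_eq_intros)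
    from diff_chain_at[OF this has_derivative[OF lU[OF that]]]
    have "(X \<circ> l has_derivative (\<lambda>h. frechet_derivative X (at (l t)) (h *\<^sub>R (y - x)))) (at t)"
      by (simp add: o_def)
    then show ?thesis
      by (simp add: has_vector_derivative_def D_def X_def o_assoc
          linear_scale[OF linear_frechet_derivative[OF differentiable[OF lU[OF that], unfolded X_def]]])
  qed
  have "continuous_on {0..1} D"
  proof -
    have "continuous_on {0..1} (\<lambda>t. \<Sum>i\<in>UNIV. (y - x) $ i *\<^sub>R partial_deriv X i (l t))"
      by (intro continuous_on_sum continuous_on_scaleR continuous_on_const
          continuous_on_compose2[OF continuous_on_partial cl]) (use lU in auto)
    then show ?thesis
      by (rule continuous_on_cong[THEN iffD1, OF refl, rotated])
         (simp add: D_def frechet_derivative_eq_sum[OF differentiable[OF lU]])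
  qed
  with vd have "(pos M \<circ> (\<phi> \<circ> l)) C1_differentiable_on {0..1}"
    unfolding C1_differentiable_on_def by blast
  then have "(pos M \<circ> (\<phi> \<circ> l)) piecewise_C1_differentiable_on {0..1}"
    by (rule C1_differentiable_imp_piecewise)
  moreover have "pathin (topo M) (\<phi> \<circ> l)"
  proof -
    have "continuous_map (top_of_set {0..1}) (top_of_set U) l"
      using lU cl by (auto simp: continuous_map_in_subtopology)
    from continuous_map_compose[OF this chart_facts(3)[OF sm c]] show ?thesis
      by (simp add: pathin_def)
  qed
  ultimately have "\<phi> \<circ> l \<in> curves M (\<phi> x) (\<phi> y)"
    by (simp add: curves_def l_def)
  then have "riem_dist M (\<phi> x) (\<phi> y) \<le> curve_length M (\<phi> \<circ> l)"
    unfolding riem_dist_def by (rule INF_lower)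
  also have "\<dots> \<le> (\<integral>\<^sup>+t. ennreal B * indicator {0..1::real} t \<partial>lborel)"
    unfolding curve_length_def
  proof (rule nn_integral_mono)
    fix t :: real
    have "sqrt (lorentz (D t) (D t)) \<le> B" if "t \<in> {0..1}"
    proof -
      have "norm (D t) \<le> B" using bound[OF l[OF that]] by (simp add: D_def X_def)
      then have "lorentz (D t) (D t) \<le> B\<^sup>2"
        using lorentz_le_norm_sq[of "D t"] power_mono[of "norm (D t)" B 2] by simp
      then show ?thesis using B by (rule real_le_lsqrt[rotated -1])
    qed
    then show "ennreal (sqrt (lorentz (vector_derivative (pos M \<circ> (\<phi> \<circ> l)) (at t))
        (vector_derivative (pos M \<circ> (\<phi> \<circ> l)) (at t)))) * indicator {0..1} t
      \<le> ennreal B * indicator {0..1} t"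
      using vector_derivative_at[OF vd] by (auto simp: indicator_def intro!: ennreal_leI)
  qed
  also have "\<dots> = ennreal B * emeasure lborel {0..1::real}"
    by (rule nn_integral_cmult_indicator) simp
  finally show ?thesis by simp
qed

text \<open>The Lipschitz condition refers to \<open>riem_dist\<close>, whose relation to the
  topology has to be established. On a small ball of a chart the partial derivatives of the
  immersion are bounded, so the Riemannian distance to the centre is at most a constant times the
  Euclidean one.\<close>

lemma lipschitz_continuous_map:
  assumes M: "immersed_hypersurface M" and f: "lipschitz_compact_support M f"
  shows "continuous_map (topo M) euclideanreal f"
proof (rule continuous_map_chartwise)
  show sm: "smooth_manifold M" using M by (simp add: immersed_hypersurface_def)
  fix U \<phi> assume c: "(U, \<phi>) \<in> charts M"
  interpret immersed_patch U "pos M \<circ> \<phi>" by (rule chart_immersed_patch[OF M c])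
  obtain L where L: "\<And>p q. p \<in> topspace (topo M) \<Longrightarrow> q \<in> topspace (topo M) \<Longrightarrow>
      ennreal \<bar>f p - f q\<bar> \<le> ennreal L * riem_dist M p q"
    using f unfolding lipschitz_compact_support_def by blast
  show "continuous_on U (\<lambda>x. f (\<phi> x))"
    unfolding continuous_on_eq_continuous_at[OF open_dom]
  proof
    fix x assume x: "x \<in> U"
    obtain r where r: "r > 0" "cball x r \<subseteq> U"
      using open_contains_cball open_dom x by blast
    let ?S = "\<lambda>z. \<Sum>i\<in>UNIV. norm (partial_deriv (pos M \<circ> \<phi>) i z)"
    have "compact (?S ` cball x r)"
      by (intro compact_continuous_image continuous_on_sum continuous_on_norm
          continuous_on_subset[OF continuous_on_partial r(2)]) simp
    then have "bounded (?S ` cball x r)" by (rule compact_imp_bounded)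
    then obtain B where B0: "\<forall>z\<in>?S ` cball x r. norm z \<le> B" unfolding bounded_iff by blast
    have B: "norm (partial_deriv (pos M \<circ> \<phi>) i z) \<le> B" if "z \<in> cball x r" for i z
    proof -
      have "norm (partial_deriv (pos M \<circ> \<phi>) i z) \<le> ?S z" by (rule member_le_sum) auto
      also have "?S z \<le> norm (?S z)" by simp
      also have "\<dots> \<le> B" using B0 that by blast
      finally show ?thesis .
    qed
    have "0 \<le> B" using order_trans[OF norm_ge_zero B[of x]] r by simp
    \<comment> \<open>The constant is that of \<open>norm_frechet_derivative_le\<close>;
      \<open>'b\<close> is the inferred name of the coordinate index type.\<close>
    define K where "K = real CARD('b) * B"
    have "0 \<le> K" using \<open>0 \<le> B\<close> by (simp add: K_def)
    \<comment> \<open>The coercion \<open>ennreal\<close> truncates negative reals to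
      \<open>0\<close>, hence \<open>max 0 L\<close> for a Lipschitz constant of unknown
      sign.\<close>
    have le: "\<bar>f (\<phi> y) - f (\<phi> x)\<bar> \<le> max 0 L * K * norm (y - x)" if y: "y \<in> cball x r" for y
    proof -
      have seg: "closed_segment x y \<subseteq> cball x r"
        by (rule closed_segment_subset) (use y r in auto)
      have d: "riem_dist M (\<phi> x) (\<phi> y) \<le> ennreal (K * norm (y - x))"
      proof (rule riem_dist_chart_le[OF M c])
        show "closed_segment x y \<subseteq> U" "0 \<le> K * norm (y - x)" using seg r \<open>0 \<le> K\<close> by auto
        fix z assume "z \<in> closed_segment x y"
        then have z: "z \<in> cball x r" "z \<in> U" using seg r by auto
        show "norm (frechet_derivative (pos M \<circ> \<phi>) (at z) (y - x)) \<le> K * norm (y - x)"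
          unfolding K_def by (rule norm_frechet_derivative_le[OF differentiable[OF z(2)] B[OF z(1)]])
      qed
      have "\<phi> x \<in> topspace (topo M)" "\<phi> y \<in> topspace (topo M)"
        using chart_facts(5)[OF sm c] x subsetD[OF r(2) y] by auto
      then have "ennreal \<bar>f (\<phi> x) - f (\<phi> y)\<bar> \<le> ennreal L * riem_dist M (\<phi> x) (\<phi> y)" by (rule L)
      also have "\<dots> \<le> ennreal (max 0 L) * ennreal (K * norm (y - x))"
        by (intro mult_mono d) (auto intro: ennreal_leI)
      also have "\<dots> = ennreal (max 0 L * (K * norm (y - x)))"
        by (rule ennreal_mult[symmetric]) (use \<open>0 \<le> K\<close> in auto)
      finally have "\<bar>f (\<phi> x) - f (\<phi> y)\<bar> \<le> max 0 L * (K * norm (y - x))"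
        by (subst (asm) ennreal_le_iff) (use \<open>0 \<le> K\<close> in auto)
      then show ?thesis by (simp add: abs_minus_commute mult_ac)
    qed
    have "((\<lambda>y. f (\<phi> y)) \<longlongrightarrow> f (\<phi> x)) (at x)"
    proof (rule LIM_zero_cancel, rule Lim_null_comparison)
      have "\<forall>\<^sub>F y in at x. y \<in> cball x r"
        by (rule eventually_at_in_open'[THEN eventually_mono, of "ball x r"]) (use r in auto)
      then show "\<forall>\<^sub>F y in at x. norm (f (\<phi> y) - f (\<phi> x)) \<le> max 0 L * K * norm (y - x)"
        by (rule eventually_mono) (use le in auto)
      have "((\<lambda>y. max 0 L * K * norm (y - x)) \<longlongrightarrow> max 0 L * K * norm (x - x)) (at x)"
        by (intro tendsto_intros)
      then show "((\<lambda>y. max 0 L * K * norm (y - x)) \<longlongrightarrow> 0) (at x)" by simp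
    qed
    then show "isCont (\<lambda>x. f (\<phi> x)) x" by (simp add: isCont_def)
  qed
qed

text \<open>The composition is continuous, bounded on the compact support of \<open>f\<close> and
  zero outside because \<open>h 0 = 0\<close>; the support has finite volume. The two instances
  needed are the square and the Sobolev power.\<close>

lemma compact_support_integrable:
  fixes h :: "real \<Rightarrow> real"
  assumes M: "immersed_hypersurface M" and f: "continuous_map (topo M) euclideanreal f"
    and K: "compactin (topo M) (topo M closure_of {p \<in> topspace (topo M). f p \<noteq> 0})"
    and h: "continuous_on UNIV h" "h 0 = 0"
  shows "integrable (riem_volume M) (\<lambda>p. h (f p))"
proof -
  let ?K = "topo M closure_of {p \<in> topspace (topo M). f p \<noteq> 0}"
  have hf: "continuous_map (topo M) euclideanreal (\<lambda>p. h (f p))"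
    using continuous_map_compose[OF f, of euclideanreal h] h(1) by (simp add: o_def)
  have meas: "(\<lambda>p. h (f p)) \<in> borel_measurable (riem_volume M)"
    using continuous_map_borel_on[OF hf] measurable_cong_sets[OF sets_riem_volume[OF M] refl] by blast
  have "compact ((\<lambda>p. h (f p)) ` ?K)"
    using image_compactin[OF K hf] by simp
  then have "bounded ((\<lambda>p. h (f p)) ` ?K)" by (rule compact_imp_bounded)
  then obtain C where C: "\<And>p. p \<in> ?K \<Longrightarrow> norm (h (f p)) \<le> C" unfolding bounded_iff by blast
  have sub: "{p \<in> topspace (topo M). f p \<noteq> 0} \<subseteq> ?K" by (rule closure_of_subset) auto
  show ?thesis
  proof (rule integrableI_bounded_set[OF compact_finite_riem_volume(1)[OF M K] meas compact_finite_riem_volume(2)[OF M K]])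
    show "AE p in riem_volume M. p \<in> ?K \<longrightarrow> norm (h (f p)) \<le> C" using C by simp
    show "AE p in riem_volume M. p \<notin> ?K \<longrightarrow> h (f p) = 0"
      by (rule AE_I2) (use sub h(2) space_riem_volume[OF M] in auto)
  qed
qed

text \<open>Hoelder's inequality by integrating Young's inequality for
  \<open>u = c * a\<^sup>2\<close> and \<open>v = f\<^sup>2 / \<beta> powr (1 / Q)\<close>. With
  this scaling \<open>u powr P\<close> has integral at most \<open>1\<close> and
  \<open>v powr Q\<close> has integral \<open>1\<close>, so the product \<open>u * v\<close> has
  integral at most \<open>1 / P + 1 / Q = 1\<close>. The integrable majorant also gives
  integrability of the product.\<close>

lemma integral_mult_sq_le:
  fixes a f :: "'a \<Rightarrow> real" and n :: nat
  assumes n: "3 \<le> n" and c: "0 < c"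
    and meas [measurable]: "a \<in> borel_measurable N" "f \<in> borel_measurable N"
    and a: "\<And>x. x \<in> space N \<Longrightarrow> 0 \<le> a x"
    and an: "(\<integral>\<^sup>+x. ennreal (a x ^ n) \<partial>N) \<le> ennreal ((1 / c) powr (real n / 2))"
    and fq: "integrable N (\<lambda>x. \<bar>f x\<bar> powr (2 * real n / (real n - 2)))"
  shows "integrable N (\<lambda>x. (a x)\<^sup>2 * (f x)\<^sup>2)"
    and "(LINT x|N. (a x)\<^sup>2 * (f x)\<^sup>2) \<le>
      (1 / c) * (LINT x|N. \<bar>f x\<bar> powr (2 * real n / (real n - 2))) powr ((real n - 2) / real n)"
proof -
  let ?q = "2 * real n / (real n - 2)"
  define P where "P = real n / 2"
  define Q where "Q = real n / (real n - 2)"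
  have PQ: "P > 1" "Q > 1" "1 / P + 1 / Q = 1"
    using n by (simp_all add: P_def Q_def field_simps)
  define \<alpha> where "\<alpha> = (LINT x|N. a x ^ n)"
  define \<beta> where "\<beta> = (LINT x|N. \<bar>f x\<bar> powr ?q)"
  have ian: "integrable N (\<lambda>x. a x ^ n)"
    by (rule integrableI_nonneg) (use a an in \<open>auto intro!: AE_I2 simp: top.extremum_strict le_less_trans\<close>)
  have "ennreal \<alpha> \<le> ennreal ((1 / c) powr P)"
    using an unfolding \<alpha>_def P_def by (subst nn_integral_eq_integral[OF ian, symmetric]) (use a in auto)
  then have \<alpha>: "\<alpha> \<le> (1 / c) powr P" by (subst (asm) ennreal_le_iff) auto
  have \<beta>0: "0 \<le> \<beta>" unfolding \<beta>_def by (rule integral_nonneg_AE) auto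
  have "integrable N (\<lambda>x. (a x)\<^sup>2 * (f x)\<^sup>2) \<and> (LINT x|N. (a x)\<^sup>2 * (f x)\<^sup>2) \<le> (1 / c) * \<beta> powr (1 / Q)"
  proof (cases "\<beta> = 0")
    case True
    \<comment> \<open>The scaling by a power of \<open>\<beta>\<close> is impossible here, but then
      \<open>f\<close> vanishes almost everywhere and both sides are \<open>0\<close>.\<close>
    then have "AE x in N. \<bar>f x\<bar> powr ?q = 0"
      unfolding \<beta>_def by (subst (asm) integral_nonneg_eq_0_iff_AE[OF fq]) auto
    then have "AE x in N. (a x)\<^sup>2 * (f x)\<^sup>2 = 0" by (rule AE_mp) (auto intro!: AE_I2)
    then have "integrable N (\<lambda>x. (a x)\<^sup>2 * (f x)\<^sup>2) = integrable N (\<lambda>x. 0 :: real)"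
      "(LINT x|N. (a x)\<^sup>2 * (f x)\<^sup>2) = (LINT x|N. 0)"
      by (intro integrable_cong_AE integral_cong_AE; simp)+
    then show ?thesis by (simp add: True)
  next
    case False
    then have \<beta>: "0 < \<beta>" using \<beta>0 by simp
    \<comment> \<open>The right-hand side of Young's inequality, multiplied by
      \<open>\<beta> powr (1 / Q) / c\<close> to undo the scaling of the two factors.\<close>
    define g where "g x = \<beta> powr (1 / Q) / c * (c powr P * a x ^ n / P + \<bar>f x\<bar> powr ?q / \<beta> / Q)" for x
    have ig: "integrable N g" unfolding g_def using ian fq by simp
    have le: "(a x)\<^sup>2 * (f x)\<^sup>2 \<le> g x" if x: "x \<in> space N" for x
    proof -
      let ?u = "c * (a x)\<^sup>2" and ?v = "(f x)\<^sup>2 / \<beta> powr (1 / Q)"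
      have "?u * ?v \<le> ?u powr P / P + ?v powr Q / Q"
        by (rule Youngs_inequality[OF PQ]) (use c in auto)
      moreover have "?u powr P = c powr P * a x ^ n"
      proof -
        have "((a x)\<^sup>2) powr P = a x ^ n"
        proof (cases "a x = 0")
          case True then show ?thesis using n by simp
        next
          case False
          then have "0 < a x" using a[OF x] by simp
          then have "(a x)\<^sup>2 = a x powr 2" "a x ^ n = a x powr real n"
            by (simp_all add: powr_realpow)
          then show ?thesis by (simp only: powr_powr) (simp add: P_def)
        qed
        then show ?thesis using c by (simp add: powr_mult)
      qed
      moreover have "?v powr Q = \<bar>f x\<bar> powr ?q / \<beta>"
      proof -
        have "((f x)\<^sup>2) powr Q = \<bar>f x\<bar> powr ?q"
        proof (cases "f x = 0")
          case True then show ?thesis by simp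
        next
          case False
          then have "(f x)\<^sup>2 = \<bar>f x\<bar> powr 2" by simp
          then show ?thesis by (simp only: powr_powr) (simp add: Q_def)
        qed
        moreover have "(\<beta> powr (1 / Q)) powr Q = \<beta>"
          using \<beta> PQ by (simp add: powr_powr)
        ultimately show ?thesis by (simp add: powr_divide)
      qed
      ultimately have "?u * ?v \<le> c powr P * a x ^ n / P + \<bar>f x\<bar> powr ?q / \<beta> / Q" by simp
      then have "\<beta> powr (1 / Q) / c * (?u * ?v) \<le> g x"
        unfolding g_def by (rule mult_left_mono) (use c in auto)
      also have "\<beta> powr (1 / Q) / c * (?u * ?v) = (a x)\<^sup>2 * (f x)\<^sup>2" using c \<beta> by simp
      finally show ?thesis .
    qed
    have int: "integrable N (\<lambda>x. (a x)\<^sup>2 * (f x)\<^sup>2)"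
    proof (rule Bochner_Integration.integrable_bound[OF ig])
      show "AE x in N. norm ((a x)\<^sup>2 * (f x)\<^sup>2) \<le> norm (g x)"
      proof (rule AE_I2)
        fix x assume "x \<in> space N"
        from le[OF this] show "norm ((a x)\<^sup>2 * (f x)\<^sup>2) \<le> norm (g x)" by simp
      qed
    qed simp
    have "(LINT x|N. (a x)\<^sup>2 * (f x)\<^sup>2) \<le> (LINT x|N. g x)"
      by (rule integral_mono_AE[OF int ig]) (use le in auto)
    also have "\<dots> = \<beta> powr (1 / Q) / c * (c powr P * \<alpha> / P + \<beta> / \<beta> / Q)"
      unfolding g_def \<alpha>_def \<beta>_def using ian fq by simp
    also have "\<dots> \<le> \<beta> powr (1 / Q) / c * (1 / P + 1 / Q)"
    proof (rule mult_left_mono)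
      \<comment> \<open>The threshold in the hypothesis on \<open>a\<close> is calibrated for this
        step: it brings the first normalized integral down to at most \<open>1\<close>.\<close>
      have "c powr P * \<alpha> \<le> c powr P * (1 / c) powr P"
        using \<alpha> by (rule mult_left_mono) simp
      also have "\<dots> = 1" using c by (simp add: powr_mult[symmetric])
      finally have "c powr P * \<alpha> / P \<le> 1 / P"
        by (rule divide_right_mono) (use PQ in simp)
      then show "c powr P * \<alpha> / P + \<beta> / \<beta> / Q \<le> 1 / P + 1 / Q"
        using \<beta> by simp
    qed (use c in auto)
    finally show ?thesis using int PQ(3) by simp
  qed
  then show "integrable N (\<lambda>x. (a x)\<^sup>2 * (f x)\<^sup>2)"
    "(LINT x|N. (a x)\<^sup>2 * (f x)\<^sup>2) \<le> (1 / c) * (LINT x|N. \<bar>f x\<bar> powr ?q) powr ((real n - 2) / real n)"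
    by (simp_all add: \<beta>_def Q_def)
qed

text \<open>The curvature bound is stated with the nonnegative integral, so it includes finiteness
  of the total curvature; a Bochner integral would be \<open>0\<close> for a non-integrable function
  and the bound would hold vacuously. Completeness and minimality of \<open>M\<close> give access to
  the Sobolev inequality.\<close>

theorem theorem3p2:
  fixes M :: "('a, 'n::finite) hypersurface" and Cs :: real
  assumes "CARD('n) \<ge> 3"
    and "Cs > 0"
    and "\<And>(N :: ('a, 'n) hypersurface) f.
           complete_minimal_hypersurface N \<Longrightarrow> lipschitz_compact_support N f \<Longrightarrow>
           sobolev_inequality Cs N f"
    and "complete_minimal_hypersurface M"
    and "(\<integral>\<^sup>+p. ennreal (normA M p ^ CARD('n)) \<partial>riem_volume M)
           \<le> ennreal ((1 / Cs) powr (real CARD('n) / 2))"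
  shows "stable_hypersurface M"
  unfolding stable_hypersurface_def
proof (intro allI impI)
  fix f assume f: "lipschitz_compact_support M f"
  let ?N = "riem_volume M" and ?n = "real CARD('n)"
  let ?g = "\<lambda>p. grad_sq M f p - ((normA M p)\<^sup>2 - ?n) * (f p)\<^sup>2"
  have M: "immersed_hypersurface M"
    using assms(4) by (simp add: complete_minimal_hypersurface_def)
  have fc: "continuous_map (topo M) euclideanreal f" by (rule lipschitz_continuous_map[OF M f])
  have K: "compactin (topo M) (topo M closure_of {p \<in> topspace (topo M). f p \<noteq> 0})"
    using f by (simp add: lipschitz_compact_support_def)
  have meas: "h \<in> borel_measurable ?N" if "continuous_map (topo M) euclideanreal h" for h
    using continuous_map_borel_on[OF that] measurable_cong_sets[OF sets_riem_volume[OF M] refl] by blast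
  have f2: "integrable ?N (\<lambda>p. (f p)\<^sup>2)"
    by (rule compact_support_integrable[OF M fc K]) (auto intro!: continuous_intros)
  \<comment> \<open>A positive exponent makes \<open>powr\<close> continuous at base
    \<open>0\<close>, that is, at the zeros of \<open>f\<close>.\<close>
  have q: "0 < 2 * ?n / (?n - 2)" using assms(1) by simp
  have fq: "integrable ?N (\<lambda>p. \<bar>f p\<bar> powr (2 * ?n / (?n - 2)))"
  proof (rule compact_support_integrable[OF M fc K, where h = "\<lambda>s. \<bar>s\<bar> powr (2 * ?n / (?n - 2))"])
    show "continuous_on UNIV (\<lambda>s::real. \<bar>s\<bar> powr (2 * ?n / (?n - 2)))"
      by (rule continuous_on_powr'[OF continuous_on_rabs[OF continuous_on_id] continuous_on_const])
         (intro ballI conjI impI abs_ge_zero q)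
  qed simp
  have a0: "0 \<le> normA M p" if "p \<in> space ?N" for p
    using normA_nonneg[OF M] that by (simp add: space_riem_volume[OF M])
  note H = integral_mult_sq_le[OF assms(1,2) meas[OF continuous_map_normA[OF M]] meas[OF fc] a0 assms(5) fq]
  show "0 \<le> (LINT p|?N. ?g p)"
  proof (cases "integrable ?N ?g")
    case False
    then show ?thesis by (simp add: not_integrable_integral_eq)
  next
    case True
    have g: "grad_sq M f = (\<lambda>p. ?g p + (normA M p)\<^sup>2 * (f p)\<^sup>2 - ?n * (f p)\<^sup>2)"
      by (simp add: fun_eq_iff algebra_simps)
    have nf2: "integrable ?N (\<lambda>p. ?n * (f p)\<^sup>2)" using f2 by simp
    have gi: "(LINT p|?N. grad_sq M f p) =
        (LINT p|?N. ?g p) + (LINT p|?N. (normA M p)\<^sup>2 * (f p)\<^sup>2) - (LINT p|?N. ?n * (f p)\<^sup>2)"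
      by (subst g) (simp only: Bochner_Integration.integral_diff[OF Bochner_Integration.integrable_add[OF True H(1)] nf2]
          Bochner_Integration.integral_add[OF True H(1)])
    have "(LINT p|?N. \<bar>f p\<bar> powr (2 * ?n / (?n - 2))) powr ((?n - 2) / ?n) \<le> Cs * (LINT p|?N. grad_sq M f p)"
      using assms(3)[OF assms(4) f] by (simp add: sobolev_inequality_def)
    \<comment> \<open>Dividing by \<open>Cs\<close> produces exactly the upper bound supplied by the
      Hoelder estimate \<open>H(2)\<close>.\<close>
    then have "(1 / Cs) * (LINT p|?N. \<bar>f p\<bar> powr (2 * ?n / (?n - 2))) powr ((?n - 2) / ?n)
        \<le> (1 / Cs) * (Cs * (LINT p|?N. grad_sq M f p))"
      by (rule mult_left_mono) (use assms(2) in auto)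
    with H(2) have "(LINT p|?N. (normA M p)\<^sup>2 * (f p)\<^sup>2) \<le> (LINT p|?N. grad_sq M f p)"
      using assms(2) by simp
    moreover have "0 \<le> (LINT p|?N. ?n * (f p)\<^sup>2)" by (rule integral_nonneg_AE) auto
    ultimately show ?thesis using gi by linarith
  qed
qed

end
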